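(* Let $(g_i)_{i\ge1},(d_i)_{i\ge1},(s_i)_{i\ge1},(a_i)_{i\ge1}$ be nonnegative real sequences and $(b_{i,j})_{i,j\ge1}$ a nonnegative array such that $a_1=0$, $a_i>0$ for $i\ge2$, $b_{i,j}=0$ for $i\ge j$, and $\sum_{i=1}^{j-1} i\,b_{i,j}=j$ for all $j\ge2$. Put $g_0=0$, $\theta_i=a_i+g_i+d_i+s_i$ and $\Delta_i^{(p)}=i^p-\sum_{j=1}^{i-1}j^p b_{j,i}$ for $i\ge2$, $p\ge0$. Suppose that for some $p_0>1$ $$\liminf_{i\to\infty}\frac{a_i}{\theta_i}\,\frac{\Delta_i^{(p_0)}}{i^{p_0}}>0 .$$ Then for every $p>1$ the operator $Y_p$ defined on $X_p$ by $$[Y_pf]_i=-\theta_if_i+g_{i-1}f_{i-1}+d_{i+1}f_{i+1}+\sum_{j=i+1}^\infty a_jb_{i,j}f_j,\quad i\ge1\ (f_0:=0),$$ with domain $D(T_p)=\{f\in X_p:\ (\theta_if_i)_{i\ge1}\in X_p\}$, generates a positive analytic $C_0$-semigroup $\{S_p(t)\}_{t\ge0}$ on $X_p$.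
   Context: For $p\ge0$, $X_p$ is the Banach space of real sequences $f=(f_i)_{i\ge1}$ with $\|f\|_p=\sum_{i\ge1}i^p|f_i|<\infty$. Positivity of the semigroup means it maps nonnegative sequences to nonnegative sequences. *)

theory Defs
  imports "HOL-Analysis.Analysis"
begin

text \<open>Sequences (f_i)_{i>=1} are encoded as functions nat => 'a with f 0 = 0
  (this is exactly the convention f_0 := 0).  The space X_p, with norm
  sum_i i^p |f_i|, is used over the reals and (for analyticity) over the
  complex numbers (its natural complexification).\<close>

definition wnorm :: "real \<Rightarrow> (nat \<Rightarrow> 'a::real_normed_vector) \<Rightarrow> real" where
  "wnorm p f = (\<Sum>i. real i powr p * norm (f i))"

definition Xsp :: "real \<Rightarrow> (nat \<Rightarrow> 'a::real_normed_vector) set" where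
  "Xsp p = {f. f 0 = 0 \<and> summable (\<lambda>i. real i powr p * norm (f i))}"

definition bounded_op :: "real \<Rightarrow> ((nat \<Rightarrow> 'a::real_normed_field) \<Rightarrow> (nat \<Rightarrow> 'a)) \<Rightarrow> bool" where
  "bounded_op p T \<longleftrightarrow>
     (\<forall>f\<in>Xsp p. T f \<in> Xsp p) \<and>
     (\<forall>f\<in>Xsp p. \<forall>g\<in>Xsp p. T (\<lambda>i. f i + g i) = (\<lambda>i. T f i + T g i)) \<and>
     (\<forall>c. \<forall>f\<in>Xsp p. T (\<lambda>i. c * f i) = (\<lambda>i. c * T f i)) \<and>
     (\<exists>M. \<forall>f\<in>Xsp p. wnorm p (T f) \<le> M * wnorm p f)"

definition C0_semigroup :: "real \<Rightarrow> (real \<Rightarrow> (nat \<Rightarrow> real) \<Rightarrow> (nat \<Rightarrow> real)) \<Rightarrow> bool" where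
  "C0_semigroup p S \<longleftrightarrow>
     (\<forall>t\<ge>0. bounded_op p (S t)) \<and>
     (\<forall>f\<in>Xsp p. S 0 f = f) \<and>
     (\<forall>s\<ge>0. \<forall>t\<ge>0. \<forall>f\<in>Xsp p. S (s + t) f = S s (S t f)) \<and>
     (\<forall>f\<in>Xsp p. ((\<lambda>t. wnorm p (\<lambda>i. S t f i - f i)) \<longlongrightarrow> 0) (at_right 0))"

definition is_generator :: "real \<Rightarrow> (real \<Rightarrow> (nat \<Rightarrow> real) \<Rightarrow> (nat \<Rightarrow> real))
    \<Rightarrow> ((nat \<Rightarrow> real) \<Rightarrow> (nat \<Rightarrow> real)) \<Rightarrow> (nat \<Rightarrow> real) set \<Rightarrow> bool" where
  "is_generator p S A D \<longleftrightarrow>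
     D = {f\<in>Xsp p. \<exists>g\<in>Xsp p.
            ((\<lambda>t. wnorm p (\<lambda>i. (S t f i - f i) / t - g i)) \<longlongrightarrow> 0) (at_right 0)} \<and>
     (\<forall>f\<in>D. A f \<in> Xsp p \<and>
            ((\<lambda>t. wnorm p (\<lambda>i. (S t f i - f i) / t - A f i)) \<longlongrightarrow> 0) (at_right 0))"

definition positive_semigroup :: "real \<Rightarrow> (real \<Rightarrow> (nat \<Rightarrow> real) \<Rightarrow> (nat \<Rightarrow> real)) \<Rightarrow> bool" where
  "positive_semigroup p S \<longleftrightarrow>
     (\<forall>t\<ge>0. \<forall>f\<in>Xsp p. (\<forall>i. 0 \<le> f i) \<longrightarrow> (\<forall>i. 0 \<le> S t f i))"

definition cplx :: "((nat \<Rightarrow> real) \<Rightarrow> (nat \<Rightarrow> real)) \<Rightarrow> (nat \<Rightarrow> complex) \<Rightarrow> (nat \<Rightarrow> complex)" where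
  "cplx T h = (\<lambda>i. complex_of_real (T (\<lambda>k. Re (h k)) i) + \<i> * complex_of_real (T (\<lambda>k. Im (h k)) i))"

definition sector :: "real \<Rightarrow> complex set" where
  "sector \<delta> = {z. z \<noteq> 0 \<and> \<bar>Arg z\<bar> < \<delta>}"

text \<open>Analytic semigroup (Pazy, Def. 2.5.1, via complexification): the
  complexified semigroup extends to a family T(z), z in a sector, of bounded
  linear operators, with the semigroup law, (strong) holomorphy in the open
  sector and strong continuity at 0 within the sector.\<close>
definition analytic_semigroup :: "real \<Rightarrow> (real \<Rightarrow> (nat \<Rightarrow> real) \<Rightarrow> (nat \<Rightarrow> real)) \<Rightarrow> bool" where
  "analytic_semigroup p S \<longleftrightarrow>
     (\<exists>\<delta>>0. \<exists>T :: complex \<Rightarrow> (nat \<Rightarrow> complex) \<Rightarrow> (nat \<Rightarrow> complex).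
        (\<forall>t\<ge>0. \<forall>h\<in>Xsp p. T (complex_of_real t) h = cplx (S t) h) \<and>
        (\<forall>z\<in>sector \<delta>. bounded_op p (T z)) \<and>
        (\<forall>z1\<in>sector \<delta>. \<forall>z2\<in>sector \<delta>. \<forall>h\<in>Xsp p. T (z1 + z2) h = T z1 (T z2 h)) \<and>
        (\<forall>h\<in>Xsp p. \<forall>z0\<in>sector \<delta>. \<exists>g\<in>Xsp p.
            ((\<lambda>z. wnorm p (\<lambda>i. (T z h i - T z0 h i) / (z - z0) - g i)) \<longlongrightarrow> 0) (at z0)) \<and>
        (\<forall>h\<in>Xsp p. ((\<lambda>z. wnorm p (\<lambda>i. T z h i - h i)) \<longlongrightarrow> 0) (at 0 within sector \<delta>)))"

definition Yop :: "(nat \<Rightarrow> real) \<Rightarrow> (nat \<Rightarrow> real) \<Rightarrow> (nat \<Rightarrow> real) \<Rightarrow> (nat \<Rightarrow> real)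
    \<Rightarrow> (nat \<Rightarrow> nat \<Rightarrow> real) \<Rightarrow> (nat \<Rightarrow> real) \<Rightarrow> nat \<Rightarrow> real" where
  "Yop \<theta> g d a b f i =
     (if i = 0 then 0
      else - \<theta> i * f i + g (i - 1) * f (i - 1) + d (i + 1) * f (i + 1)
           + (\<Sum>j. if i < j then a j * b i j * f j else 0))"

end

theory Submission
  imports Defs "HOL-Complex_Analysis.Cauchy_Integral_Formula"
begin

text \<open>
  Write the operator as \<open>-\<Theta> + B\<close> with \<open>\<Theta>\<close> diagonal and \<open>B \<ge> 0\<close>. Comparing \<open>1 - x\<^sup>r\<close> for different exponents
  carries the liminf condition from \<open>p\<^sub>0\<close> to every \<open>p > 1\<close>, and then the columns of \<open>B\<close> satisfy
  \<open>\<Sum>\<^sub>k k\<^sup>p B\<^sub>k\<^sub>j \<le> \<kappa> (\<theta>\<^sub>j + \<omega>) j\<^sup>p\<close> with \<open>\<kappa> < 1\<close>.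
  The adjoint (backward) equation \<open>v\<^sub>j' = -\<theta>\<^sub>j v\<^sub>j + \<Sum>\<^sub>k B\<^sub>k\<^sub>j v\<^sub>k\<close> has only finite sums, since \<open>B\<^sub>k\<^sub>j = 0\<close> for \<open>k > j + 1\<close>,
  and in the dual norm \<open>sup\<^sub>j |v\<^sub>j| / j\<^sup>p\<close> its Dyson-Phillips series of entire functions converges geometrically, not only
  for \<open>t \<ge> 0\<close> but on a cone \<open>c |z| \<le> Re z\<close> with \<open>\<kappa> < c < 1\<close>. The same contraction gives uniqueness, hence the
  semigroup law. Norms in \<open>X\<^sub>p\<close> are column norms, which by duality reduce to estimates for scalar holomorphic functions:
  this yields strong continuity, holomorphy (through Cauchy's inequality) and the generator on \<open>D(\<Theta>)\<close>. The generator is no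
  larger, because a Neumann series shows that \<open>\<mu> - Y\<close> maps \<open>D(\<Theta>)\<close> onto \<open>X\<^sub>p\<close> and exponential growth bounds make
  \<open>\<mu>\<close> minus the generator injective for \<open>\<mu> > \<omega>\<close>.
\<close>

subsection \<open>Infinite matrices acting on weighted sequence spaces\<close>

text \<open>The obstacle is that \<open>B\<close> may have infinite rows and the rates
  \<open>\<theta>\<close> may be unbounded, so the forward equation is neither a finite system nor a
  bounded perturbation. Transposing removes the convergence questions, but on a sup-type dual space
  it loses strong continuity. What repairs this is finite propagation: each Dyson term looks only
  one index further up. The exponent 1 is critical: the mass condition makes the deficit of order 1
  vanish, and only for \<open>p > 1\<close> does fragmentation lose a positive share of the moment.
  That share is the source of \<open>\<kappa> < 1\<close>. On a ray with
  \<open>c |z| \<le> Re z\<close>, arc length is at most \<open>1 / c\<close> times the increase of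
  \<open>Re z\<close>. Solving against the decay rate \<open>\<zeta> j\<close> therefore costs
  \<open>1 / (c * \<zeta> j)\<close>, the unbounded rate cancels, and one Dyson step contracts by
  \<open>\<kappa> / c\<close>. Hence any half-angle \<open>arccos c\<close> with
  \<open>\<kappa> < c < 1\<close> is admissible. The shift \<open>\<omega>\<close> pays for the
  finitely many columns about which the liminf says nothing; its price is a growth factor
  \<open>exp (\<omega> * Re z)\<close>.\<close>

definition matop :: "(nat \<Rightarrow> nat \<Rightarrow> 'a::{real_normed_field,banach}) \<Rightarrow> (nat \<Rightarrow> 'a) \<Rightarrow> nat \<Rightarrow> 'a" where
  "matop M f i = (\<Sum>j. M i j * f j)"

text \<open>Row \<open>0\<close> is forced to vanish, because the elements of \<^const>\<open>Xsp\<close> do at the junk index \<open>0\<close>.\<close>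
definition colbd :: "real \<Rightarrow> (nat \<Rightarrow> nat \<Rightarrow> 'a::{real_normed_field,banach}) \<Rightarrow> (nat \<Rightarrow> real) \<Rightarrow> bool" where
  "colbd p M m \<longleftrightarrow> (\<forall>j. M 0 j = 0) \<and> (\<forall>j N. (\<Sum>i\<le>N. real i powr p * norm (M i j)) \<le> m j)"

lemma XspI_wnorm_le:
  fixes f :: "nat \<Rightarrow> 'a::real_normed_vector"
  assumes "f 0 = 0" "\<And>N. (\<Sum>i\<le>N. real i powr p * norm (f i)) \<le> K"
  shows "f \<in> Xsp p" "wnorm p f \<le> K"
proof -
  have s: "summable (\<lambda>i. real i powr p * norm (f i))"
    by (rule bounded_imp_summable[OF _ assms(2)]) auto
  then show "f \<in> Xsp p"
    using assms(1) by (simp add: Xsp_def)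
  have "(\<Sum>i<n. real i powr p * norm (f i)) \<le> K" for n
    using assms(2)[of n] sum_mono2[of "{..n}" "{..<n}" "\<lambda>i. real i powr p * norm (f i)"] by force
  then show "wnorm p f \<le> K"
    unfolding wnorm_def by (rule suminf_le_const[OF s])
qed

lemma wnorm_nonneg: "f \<in> Xsp p \<Longrightarrow> 0 \<le> wnorm p f"
  by (auto simp: Xsp_def wnorm_def intro!: suminf_nonneg)

text \<open>Dominated convergence along an arbitrary filter: the limits below run over complex
  neighbourhoods and \<open>at_right 0\<close> as well as over the naturals.\<close>

lemma tendsto_suminf_dominated:
  fixes a :: "nat \<Rightarrow> 'b \<Rightarrow> 'a :: {real_normed_algebra, banach}"
  assumes lim: "\<And>k. ((\<lambda>n. a k n) \<longlongrightarrow> b k) F"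
    and bound: "eventually (\<lambda>n. \<forall>k. norm (a k n) \<le> M k) F"
    and M: "summable M"
  shows "((\<lambda>n. \<Sum>k. a k n) \<longlongrightarrow> (\<Sum>k. b k)) F"
proof (cases "F = bot")
  case False
  have "\<forall>\<^sub>F (x, n) in sequentially \<times>\<^sub>F F. \<forall>k. norm (a k n) \<le> M k"
    using bound by (simp add: eventually_prod2)
  then have "\<forall>\<^sub>F (k, n) in sequentially \<times>\<^sub>F F. norm (a k n) \<le> M k"
    by (rule eventually_mono) auto
  from tannerys_theorem[OF lim this M False] show ?thesis by blast
qed simp

lemma Xsp_cmult:
  fixes f :: "nat \<Rightarrow> 'a::real_normed_field"
  assumes "f \<in> Xsp p"
  shows "(\<lambda>i. c * f i) \<in> Xsp p"
  using assms summable_mult[of "\<lambda>i. real i powr p * norm (f i)" "norm c"]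
  by (simp add: Xsp_def norm_mult mult.left_commute)

lemma Xsp_add:
  fixes f :: "nat \<Rightarrow> 'a::real_normed_vector"
  assumes "f \<in> Xsp p" "h \<in> Xsp p"
  shows "(\<lambda>i. f i + h i) \<in> Xsp p"
proof -
  have "norm (real i powr p * norm (f i + h i)) \<le> real i powr p * norm (f i) + real i powr p * norm (h i)" for i
    using mult_left_mono[OF norm_triangle_ineq[of "f i" "h i"], of "real i powr p"] by (simp add: distrib_left)
  then have "summable (\<lambda>i. real i powr p * norm (f i + h i))"
    using assms summable_add[of "\<lambda>i. real i powr p * norm (f i)" "\<lambda>i. real i powr p * norm (h i)"]
    by (auto simp: Xsp_def intro: summable_comparison_test')
  then show ?thesis using assms by (simp add: Xsp_def)
qed

lemma entry_le_wnorm: "f \<in> Xsp p \<Longrightarrow> real i powr p * norm (f i) \<le> wnorm p f"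
  using sum_le_suminf[of "\<lambda>i. real i powr p * norm (f i)" "{i}"]
  by (auto simp: Xsp_def wnorm_def)

lemma colbd_entry:
  assumes "colbd p M m"
  shows "real i powr p * norm (M i j) \<le> m j"
proof -
  have "real i powr p * norm (M i j) \<le> (\<Sum>i\<le>i. real i powr p * norm (M i j))"
    by (rule member_le_sum) auto
  then show ?thesis
    using assms unfolding colbd_def by (meson order_trans)
qed

lemma colbd_nonneg: "colbd p M m \<Longrightarrow> 0 \<le> m j"
  using colbd_entry[of p M m 0 j] by simp

lemma matop_summable:
  assumes M: "colbd p M m" and s: "summable (\<lambda>j. m j * norm (f j))"
  shows "summable (\<lambda>j. norm (M i j * f j))"
proof (cases "i = 0")
  case True
  then show ?thesis using M by (simp add: colbd_def)
next
  case False
  then have i: "real i powr p > 0" by simp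
  show ?thesis
  proof (rule summable_comparison_test'[OF summable_mult[OF s, of "1 / real i powr p"]])
    fix j :: nat
    have "norm (M i j) \<le> m j / real i powr p"
      using colbd_entry[OF M, of i j] i by (simp add: field_simps)
    then have "norm (M i j) * norm (f j) \<le> m j / real i powr p * norm (f j)"
      by (rule mult_right_mono) simp
    then show "norm (norm (M i j * f j)) \<le> 1 / real i powr p * (m j * norm (f j))"
      by (simp add: norm_mult)
  qed
qed

text \<open>Sums are exchanged over finitely many rows at a time. The column bound \<open>m\<close>
  is arbitrary so that the unbounded matrix \<open>YM\<close> is covered as well, on those
  \<open>f\<close> that are summable against its larger weight.\<close>

lemma matop_bound:
  assumes M: "colbd p M m" and s: "summable (\<lambda>j. m j * norm (f j))"
  shows "matop M f \<in> Xsp p" "wnorm p (matop M f) \<le> (\<Sum>j. m j * norm (f j))"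
proof -
  note ms = matop_summable[OF M s]
  have 0: "matop M f 0 = 0"
    using M by (simp add: matop_def colbd_def)
  have b: "(\<Sum>i\<le>N. real i powr p * norm (matop M f i)) \<le> (\<Sum>j. m j * norm (f j))" for N
  proof -
    have "(\<Sum>i\<le>N. real i powr p * norm (matop M f i))
        \<le> (\<Sum>i\<le>N. real i powr p * (\<Sum>j. norm (M i j * f j)))"
      unfolding matop_def by (intro sum_mono mult_left_mono summable_norm ms) auto
    also have "\<dots> = (\<Sum>i\<le>N. (\<Sum>j. real i powr p * norm (M i j * f j)))"
      by (intro sum.cong refl suminf_mult[symmetric] ms)
    also have "\<dots> = (\<Sum>j. (\<Sum>i\<le>N. real i powr p * norm (M i j * f j)))"
      by (intro suminf_sum[symmetric] summable_mult ms)
    also have "\<dots> \<le> (\<Sum>j. m j * norm (f j))"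
    proof (intro suminf_le summable_sum summable_mult ms s)
      fix j
      have "(\<Sum>i\<le>N. real i powr p * norm (M i j * f j)) = (\<Sum>i\<le>N. real i powr p * norm (M i j)) * norm (f j)"
        by (simp add: sum_distrib_right norm_mult mult.assoc)
      also have "\<dots> \<le> m j * norm (f j)"
        using M by (intro mult_right_mono) (auto simp: colbd_def)
      finally show "(\<Sum>i\<le>N. real i powr p * norm (M i j * f j)) \<le> m j * norm (f j)" .
    qed
    finally show ?thesis .
  qed
  show "matop M f \<in> Xsp p" "wnorm p (matop M f) \<le> (\<Sum>j. m j * norm (f j))"
    using XspI_wnorm_le[OF 0 b] by auto
qed

lemma matop_add:
  assumes "colbd p M m" "summable (\<lambda>j. m j * norm (f j))" "summable (\<lambda>j. m j * norm (h j))"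
  shows "matop M (\<lambda>i. f i + h i) = (\<lambda>i. matop M f i + matop M h i)"
  unfolding matop_def
  using matop_summable[OF assms(1,2)] matop_summable[OF assms(1,3)]
  by (intro ext) (simp add: suminf_add summable_norm_cancel distrib_left)

lemma matop_cmult:
  assumes "colbd p M m" "summable (\<lambda>j. m j * norm (f j))"
  shows "matop M (\<lambda>i. c * f i) = (\<lambda>i. c * matop M f i)"
  unfolding matop_def
  using summable_norm_cancel[OF matop_summable[OF assms]]
  by (intro ext) (simp add: suminf_mult[symmetric] mult.left_commute)

lemma Xsp_summable: "f \<in> Xsp p \<Longrightarrow> summable (\<lambda>j. (C * real j powr p) * norm (f j))"
  using summable_mult[of "\<lambda>j. real j powr p * norm (f j)" C] by (simp add: Xsp_def mult.assoc)

lemma matop_bounded_op: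
  assumes M: "colbd p M (\<lambda>j. C * real j powr p)"
  shows "bounded_op p (matop M)"
proof -
  have "wnorm p (matop M f) \<le> C * wnorm p f" if "f \<in> Xsp p" for f
    using matop_bound(2)[OF M Xsp_summable[OF that]] that
    by (simp add: wnorm_def Xsp_def suminf_mult mult.assoc)
  then show ?thesis
    unfolding bounded_op_def
    using matop_bound(1)[OF M Xsp_summable] matop_add[OF M Xsp_summable Xsp_summable]
      matop_cmult[OF M Xsp_summable] by blast
qed

text \<open>Pointwise convergence of the column bounds and one dominating weight give convergence at
  a fixed \<open>f\<close>, without convergence in operator norm. Continuity at 0, holomorphy and
  the generator limit are all instances.\<close>

lemma matop_tendsto_0:
  assumes M: "eventually (\<lambda>z. colbd p (M z) (m z)) F"
    and m0: "\<And>j. ((\<lambda>z. m z j) \<longlongrightarrow> 0) F"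
    and mD: "eventually (\<lambda>z. \<forall>j. m z j \<le> D j) F"
    and s: "summable (\<lambda>j. D j * norm (f j))"
  shows "((\<lambda>z. wnorm p (matop (M z) f)) \<longlongrightarrow> 0) F"
proof -
  have ev: "eventually (\<lambda>z. \<forall>j. norm (m z j * norm (f j)) \<le> D j * norm (f j)) F"
    using M mD by eventually_elim (simp add: colbd_nonneg abs_mult mult_right_mono)
  have "((\<lambda>z. \<Sum>j. m z j * norm (f j)) \<longlongrightarrow> (\<Sum>j. 0)) F"
  proof (rule tendsto_suminf_dominated[OF _ ev s])
    show "((\<lambda>z. m z k * norm (f k)) \<longlongrightarrow> 0) F" for k
      using tendsto_mult_right[OF m0[of k], of "norm (f k)"] by simp
  qed
  then have lim: "((\<lambda>z. \<Sum>j. m z j * norm (f j)) \<longlongrightarrow> 0) F" by simp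
  show ?thesis
  proof (rule tendsto_sandwich[OF _ _ tendsto_const lim])
    have *: "eventually (\<lambda>z. colbd p (M z) (m z) \<and> summable (\<lambda>j. m z j * norm (f j))) F"
      using M ev by eventually_elim (auto intro: summable_comparison_test'[OF s])
    show "eventually (\<lambda>z. wnorm p (matop (M z) f) \<le> (\<Sum>j. m z j * norm (f j))) F"
      using * by eventually_elim (rule matop_bound(2), auto)
    show "eventually (\<lambda>z. 0 \<le> wnorm p (matop (M z) f)) F"
      using * by eventually_elim (rule wnorm_nonneg, rule matop_bound(1), auto)
  qed
qed

text \<open>The norm of a column is attained by pairing it with a sequence \<open>\<phi>\<close> of unit dual norm.\<close>
lemma colbdI_dual:
  fixes M :: "nat \<Rightarrow> nat \<Rightarrow> complex"
  assumes M0: "\<And>j. M 0 j = 0"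
    and b: "\<And>N j \<phi>. (\<And>i. norm (\<phi> i) \<le> real i powr p) \<Longrightarrow> (\<And>i. i > N \<Longrightarrow> \<phi> i = 0) \<Longrightarrow> norm (\<Sum>i\<le>N. \<phi> i * M i j) \<le> m j"
  shows "colbd p M m"
  unfolding colbd_def
proof (intro conjI allI M0)
  fix j N
  define \<phi> where "\<phi> i = (if i \<le> N then of_real (real i powr p) * cnj (sgn (M i j)) else 0)" for i
  have 1: "norm (\<phi> i) \<le> real i powr p" for i
    by (simp add: \<phi>_def norm_mult norm_sgn)
  have "(\<Sum>i\<le>N. \<phi> i * M i j) = (\<Sum>i\<le>N. of_real (real i powr p * norm (M i j)))"
  proof (rule sum.cong)
    fix i assume "i \<in> {..N}"
    have "cnj (sgn x) * x = of_real (norm x)" for x :: complex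
      using complex_norm_square[of x]
      by (cases "x = 0") (auto simp: sgn_eq mult.commute power2_eq_square divide_simps)
    then show "\<phi> i * M i j = of_real (real i powr p * norm (M i j))"
      using \<open>i \<in> {..N}\<close> by (simp add: \<phi>_def mult.assoc)
  qed simp
  also have "norm \<dots> = (\<Sum>i\<le>N. real i powr p * norm (M i j))"
    unfolding of_real_sum[symmetric] norm_of_real by (rule abs_of_nonneg) (auto intro: sum_nonneg)
  finally show "(\<Sum>i\<le>N. real i powr p * norm (M i j)) \<le> m j"
    using b[of \<phi> N j] 1 by (simp add: \<phi>_def)
qed

lemma colbd_Re:
  fixes M :: "nat \<Rightarrow> nat \<Rightarrow> complex"
  assumes "colbd p M m"
  shows "colbd p (\<lambda>i j. Re (M i j)) m"
  unfolding colbd_def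
proof (intro conjI allI)
  show "Re (M 0 j) = 0" for j using assms by (simp add: colbd_def)
  fix j N
  have "(\<Sum>i\<le>N. real i powr p * norm (Re (M i j))) \<le> (\<Sum>i\<le>N. real i powr p * norm (M i j))"
    by (intro sum_mono mult_left_mono) (auto simp: abs_Re_le_cmod)
  then show "(\<Sum>i\<le>N. real i powr p * norm (Re (M i j))) \<le> m j"
    using assms unfolding colbd_def by (meson order_trans)
qed

lemma neumann_series:
  fixes G :: "nat \<Rightarrow> nat \<Rightarrow> 'a::{real_normed_field,banach}"
  assumes G: "colbd p G (\<lambda>j. \<kappa> * real j powr p)" and k: "0 \<le> \<kappa>" "\<kappa> < 1" and h: "h \<in> Xsp p"
  shows "\<exists>x\<in>Xsp p. \<forall>i. x i = h i + matop G x i"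
proof -
  define y where "y n = (matop G ^^ n) h" for n
  have y: "y n \<in> Xsp p \<and> wnorm p (y n) \<le> \<kappa> ^ n * wnorm p h" for n
  proof (induction n)
    case 0
    then show ?case using h by (simp add: y_def)
  next
    case (Suc n)
    have "wnorm p (y (Suc n)) \<le> \<kappa> * wnorm p (y n)"
      using matop_bound(2)[OF G Xsp_summable, of "y n"] Suc
      by (simp add: wnorm_def Xsp_def suminf_mult mult.assoc y_def)
    also have "\<dots> \<le> \<kappa> * (\<kappa> ^ n * wnorm p h)"
      using Suc k by (intro mult_left_mono) auto
    finally show ?case
      using matop_bound(1)[OF G Xsp_summable, of "y n"] Suc by (simp add: y_def mult.assoc)
  qed
  have y0: "y n 0 = 0" for n using y[of n] by (simp add: Xsp_def)
  have sm: "summable (\<lambda>n. norm (y n i))" for i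
  proof (cases "i = 0")
    case False
    show ?thesis
    proof (rule summable_comparison_test'[where g = "\<lambda>n. \<kappa> ^ n * wnorm p h / real i powr p"])
      show "summable (\<lambda>n. \<kappa> ^ n * wnorm p h / real i powr p)"
        using k by (intro summable_divide summable_mult2 summable_geometric) auto
      fix n
      have "real i powr p * norm (y n i) \<le> wnorm p (y n)"
        using y[of n] by (intro entry_le_wnorm) simp
      then have "real i powr p * norm (y n i) \<le> \<kappa> ^ n * wnorm p h"
        using y[of n] by linarith
      then show "norm (norm (y n i)) \<le> \<kappa> ^ n * wnorm p h / real i powr p"
        using False by (simp add: field_simps)
    qed
  qed (simp add: y0)
  \<comment> \<open>The sum of absolute values stays in \<open>Xsp p\<close> and dominates all
    partial sums, which lets \<open>matop G\<close> pass through the limit.\<close>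
  define X where "X i = (\<Sum>n. norm (y n i))" for i
  have X: "X \<in> Xsp p"
  proof (rule XspI_wnorm_le)
    show "X 0 = 0" by (simp add: X_def y0)
    fix N
    have "(\<Sum>i\<le>N. real i powr p * norm (X i)) = (\<Sum>i\<le>N. (\<Sum>n. real i powr p * norm (y n i)))"
      by (intro sum.cong refl) (simp add: X_def suminf_mult sm suminf_nonneg)
    also have "\<dots> = (\<Sum>n. (\<Sum>i\<le>N. real i powr p * norm (y n i)))"
      by (intro suminf_sum[symmetric] summable_mult sm)
    also have "\<dots> \<le> (\<Sum>n. \<kappa> ^ n * wnorm p h)"
    proof (intro suminf_le summable_sum summable_mult sm)
      fix n
      have "(\<Sum>i\<le>N. real i powr p * norm (y n i)) \<le> wnorm p (y n)"
        unfolding wnorm_def using y[of n] by (intro sum_le_suminf) (auto simp: Xsp_def)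
      then show "(\<Sum>i\<le>N. real i powr p * norm (y n i)) \<le> \<kappa> ^ n * wnorm p h"
        using y[of n] by linarith
      show "summable (\<lambda>n. \<kappa> ^ n * wnorm p h)"
        using k by (intro summable_mult2 summable_geometric) auto
    qed
    finally show "(\<Sum>i\<le>N. real i powr p * norm (X i)) \<le> (\<Sum>n. \<kappa> ^ n * wnorm p h)" .
  qed
  define x where "x i = (\<Sum>n. y n i)" for i
  have xX: "norm (x i) \<le> norm (X i)" for i
    unfolding x_def X_def using summable_norm[OF sm[of i]] suminf_nonneg[OF sm[of i]] by simp
  have xin: "x \<in> Xsp p"
    unfolding Xsp_def
  proof (intro CollectI conjI)
    show "x 0 = 0" by (simp add: x_def y0)
    show "summable (\<lambda>i. real i powr p * norm (x i))"
      by (rule summable_comparison_test'[of "\<lambda>i. real i powr p * norm (X i)" 0])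
        (use X xX in \<open>auto simp: Xsp_def intro!: mult_left_mono\<close>)
  qed
  have yS: "matop G (\<lambda>j. \<Sum>n<N. y n j) i = (\<Sum>n<N. y (Suc n) i)" for N i
  proof (induction N)
    case 0
    then show ?case by (simp add: matop_def)
  next
    case (Suc N)
    have "(\<lambda>j. \<Sum>n<N. y n j) \<in> Xsp p"
    proof (induction N)
      case (Suc N)
      then show ?case using Xsp_add[OF Suc, of "y N"] y[of N] by simp
    qed (simp add: Xsp_def)
    then show ?case
      using matop_add[OF G Xsp_summable Xsp_summable, of "\<lambda>j. \<Sum>n<N. y n j" "y N"] y[of N] Suc
      by (simp add: y_def)
  qed
  have "x i = h i + matop G x i" for i
  proof -
    have "(\<lambda>N. \<Sum>j. G i j * (\<Sum>n<N. y n j)) \<longlonglongrightarrow> (\<Sum>j. G i j * x j)"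
    proof (rule tendsto_suminf_dominated)
      show "(\<lambda>N. G i k * (\<Sum>n<N. y n k)) \<longlonglongrightarrow> G i k * x k" for k
        unfolding x_def by (intro tendsto_mult_left summable_LIMSEQ summable_norm_cancel[OF sm])
      show "summable (\<lambda>j. norm (G i j * of_real (X j)))"
        using matop_summable[OF G, of "\<lambda>j. of_real (X j)" i] Xsp_summable[OF X] by simp
      have "norm (G i j * (\<Sum>n<N. y n j)) \<le> norm (G i j * of_real (X j))" for j N
      proof -
        have "norm (\<Sum>n<N. y n j) \<le> (\<Sum>n<N. norm (y n j))" by (rule norm_sum)
        also have "\<dots> \<le> X j" unfolding X_def by (intro sum_le_suminf sm) auto
        also have "\<dots> \<le> \<bar>X j\<bar>" by simp
        finally show ?thesis by (simp add: norm_mult mult_left_mono)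
      qed
      then show "\<forall>\<^sub>F N in sequentially. \<forall>j. norm (G i j * (\<Sum>n<N. y n j)) \<le> norm (G i j * of_real (X j))"
        by simp
    qed
    then have "(\<lambda>N. \<Sum>n<N. y (Suc n) i) \<longlonglongrightarrow> matop G x i"
      using yS unfolding matop_def by simp
    then have 1: "(\<lambda>N. h i + (\<Sum>n<N. y (Suc n) i)) \<longlonglongrightarrow> h i + matop G x i"
      by (intro tendsto_intros)
    have "(\<lambda>N. \<Sum>n<N. y n i) \<longlonglongrightarrow> x i"
      unfolding x_def by (rule summable_LIMSEQ[OF summable_norm_cancel[OF sm]])
    then have "(\<lambda>N. \<Sum>n<Suc N. y n i) \<longlonglongrightarrow> x i"
      by (rule LIMSEQ_Suc)
    moreover have "(\<Sum>n<Suc N. y n i) = h i + (\<Sum>n<N. y (Suc n) i)" for N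
      by (subst sum.lessThan_Suc_shift) (simp add: y_def)
    ultimately have "(\<lambda>N. h i + (\<Sum>n<N. y (Suc n) i)) \<longlonglongrightarrow> x i" by (simp only:)
    from LIMSEQ_unique[OF this 1] show ?thesis .
  qed
  then show ?thesis using xin by blast
qed

lemma matop_lincomb:
  assumes "summable (\<lambda>j. norm (M i j * f j))" "summable (\<lambda>j. norm (N i j * f j))"
  shows "matop (\<lambda>i j. a * M i j + b * N i j) f i = a * matop M f i + b * matop N f i"
proof -
  have "(\<lambda>j. a * (M i j * f j) + b * (N i j * f j)) sums (a * matop M f i + b * matop N f i)"
    unfolding matop_def
    by (intro sums_add sums_mult summable_sums summable_norm_cancel[OF assms(1)] summable_norm_cancel[OF assms(2)])
  then show ?thesis
    unfolding matop_def by (simp add: sums_iff algebra_simps)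
qed

text \<open>The entry at (0, 0) is 0 because \<open>colbd\<close> demands a vanishing row 0; on
  \<open>Xsp p\<close> this is still the identity, since \<open>f 0 = 0\<close>.\<close>

definition idm :: "nat \<Rightarrow> nat \<Rightarrow> 'a::{real_normed_field,banach}" where
  "idm i j = (if i = j \<and> i \<noteq> 0 then 1 else 0)"

lemma idm_sums:
  assumes "f 0 = 0"
  shows "(\<lambda>j. idm i j * f j) sums f i"
proof -
  have "(\<lambda>j. idm i j * f j) = (\<lambda>j. if j = i then f j else 0)"
    using assms by (auto simp: idm_def)
  then show ?thesis using sums_single[of i f] by simp
qed

lemma idm_summable: "summable (\<lambda>j. norm (idm i j * f j))"
  by (rule summable_finite[of "{i}"]) (auto simp: idm_def)

lemma matop_idm: "f 0 = 0 \<Longrightarrow> matop idm f i = f i"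
  unfolding matop_def using idm_sums by (rule sums_unique[symmetric])

lemma wnorm_tendsto_component:
  fixes v :: "'b \<Rightarrow> nat \<Rightarrow> 'a::real_normed_vector"
  assumes lim: "((\<lambda>z. wnorm p (v z)) \<longlongrightarrow> 0) F" and v: "eventually (\<lambda>z. v z \<in> Xsp p) F"
  shows "((\<lambda>z. v z i) \<longlongrightarrow> 0) F"
proof (cases "i = 0")
  case True
  have "eventually (\<lambda>z. v z i = 0) F"
    using v by eventually_elim (simp add: True Xsp_def)
  then show ?thesis by (rule tendsto_eventually)
next
  case False
  have l: "((\<lambda>z. wnorm p (v z) / real i powr p) \<longlongrightarrow> 0) F"
    using tendsto_divide_zero[OF lim] by simp
  show ?thesis
  proof (rule Lim_null_comparison[OF _ l])
    show "eventually (\<lambda>z. norm (v z i) \<le> wnorm p (v z) / real i powr p) F"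
      using v
    proof eventually_elim
      case (elim z)
      from entry_le_wnorm[OF this, of i] False show ?case
        by (simp add: field_simps)
    qed
  qed
qed

lemma Xsp_of_real: "(\<lambda>j. complex_of_real (f j)) \<in> Xsp p \<longleftrightarrow> f \<in> Xsp p"
  by (simp add: Xsp_def)

subsection \<open>Linear equations on a complex cone\<close>

text \<open>For \<open>0 < c < 1\<close> this is the closed sector of half-angle
  \<open>arccos c\<close> together with its vertex. The form chosen makes stability under sums and
  nonnegative scaling immediate and bounds \<open>|z|\<close> by \<open>Re z / c\<close>, which is
  how the angle enters the estimates.\<close>

definition ccone :: "real \<Rightarrow> complex set" where
  "ccone c = {z. c * norm z \<le> Re z}"

lemma mem_interior_ccone:
  assumes "c * norm z < Re z"
  shows "z \<in> interior (ccone c)"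
proof -
  have "open {z. c * norm z < Re z}"
    by (intro open_Collect_less continuous_intros)
  then have "{z. c * norm z < Re z} \<subseteq> interior (ccone c)"
    by (intro interior_maximal) (auto simp: ccone_def)
  then show ?thesis using assms by auto
qed

lemma ccone_add: "0 \<le> c \<Longrightarrow> x \<in> ccone c \<Longrightarrow> y \<in> ccone c \<Longrightarrow> x + y \<in> ccone c"
  unfolding ccone_def using mult_left_mono[OF norm_triangle_ineq[of x y], of c]
  by (simp add: distrib_left)

lemma ccone_scaleR: "0 \<le> r \<Longrightarrow> x \<in> ccone c \<Longrightarrow> of_real r * x \<in> ccone c"
  unfolding ccone_def using mult_left_mono[of "c * norm x" "Re x" r]
  by (simp add: norm_mult mult.left_commute)

lemma convex_ccone: "0 \<le> c \<Longrightarrow> convex (ccone c)"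
  by (intro convexI) (simp add: scaleR_conv_of_real ccone_add ccone_scaleR)

lemma zero_in_ccone [simp]: "0 \<in> ccone c"
  by (simp add: ccone_def)

lemma of_real_in_ccone: "c \<le> 1 \<Longrightarrow> 0 \<le> t \<Longrightarrow> complex_of_real t \<in> ccone c"
  by (simp add: ccone_def mult_right_mono[of c 1 t, simplified])

text \<open>Along the ray \<open>r * z\<close> the derivative of
  \<open>exp (\<zeta> * r * z) * u (r * z)\<close> is at most
  \<open>|z| * m * exp (\<zeta> * r * Re z)\<close>, and \<open>|z| \<le> Re z / c\<close> turns
  this into the derivative of \<open>A * exp (\<zeta> * Re z * r)\<close> with
  \<open>A = m / (c * \<zeta>)\<close>. Comparing increments replaces the integral of Duhamel's
  formula.\<close>

lemma cone_ode_bound: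
  fixes u F :: "complex \<Rightarrow> complex" and \<zeta> c m :: real
  assumes c: "0 < c" and \<zeta>: "0 < \<zeta>"
    and der: "\<And>z. z \<in> ccone c \<Longrightarrow> (u has_field_derivative (- of_real \<zeta> * u z + F z)) (at z within ccone c)"
    and F: "\<And>z. z \<in> ccone c \<Longrightarrow> norm (F z) \<le> m"
    and z: "z \<in> ccone c"
  shows "norm (u z) \<le> norm (u 0) + m / (c * \<zeta>)"
proof (cases "z = 0")
  case True
  have "0 \<le> m" using F[of 0] norm_ge_zero order_trans zero_in_ccone by blast
  then show ?thesis using True c \<zeta> by simp
next
  case False
  have m: "0 \<le> m" using F[of 0] norm_ge_zero order_trans zero_in_ccone by blast
  have Rez: "0 \<le> Re z"
    using z c unfolding ccone_def by (smt (verit) mem_Collect_eq mult_nonneg_nonneg norm_ge_zero)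
  define A where "A = m / (c * \<zeta>)"
  have A: "0 \<le> A" using m c \<zeta> by (simp add: A_def)
  define E where "E v = exp (of_real \<zeta> * v) * u v" for v
  have E: "(E has_field_derivative exp (of_real \<zeta> * v) * F v) (at v within ccone c)" if "v \<in> ccone c" for v
    unfolding E_def by (rule derivative_eq_intros der that refl | simp add: algebra_simps)+
  define l where "l r = of_real r * z" for r :: real
  have lc: "l r \<in> ccone c" if "r \<in> {0..1}" for r
    using that z by (simp add: l_def ccone_scaleR)
  have dk: "((E \<circ> l) has_vector_derivative z * (exp (of_real \<zeta> * l r) * F (l r))) (at r within {0..1})"
    if r: "r \<in> {0..1}" for r
  proof (rule field_vector_diff_chain_within)
    show "(l has_vector_derivative z) (at r within {0..1})"
      unfolding l_def by (auto intro!: derivative_eq_intros)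
    show "(E has_field_derivative exp (of_real \<zeta> * l r) * F (l r)) (at (l r) within l ` {0..1})"
      by (rule DERIV_subset[OF E[OF lc[OF r]]]) (use lc in auto)
  qed
  have "norm ((E \<circ> l) 1 - (E \<circ> l) 0) \<le> A * exp (\<zeta> * Re z * 1) - A * exp (\<zeta> * Re z * 0)"
  proof (rule differentiable_bound_general[where f' = "\<lambda>r. z * (exp (of_real \<zeta> * l r) * F (l r))"
        and \<phi>' = "\<lambda>r. A * (\<zeta> * Re z * exp (\<zeta> * Re z * r))"])
    show "continuous_on {0..1} (E \<circ> l)"
      using dk by (meson continuous_on_eq_continuous_within has_vector_derivative_continuous)
    show "continuous_on {0..1} (\<lambda>r. A * exp (\<zeta> * Re z * r))"
      by (intro continuous_intros)
    fix r :: real assume r: "0 < r" "r < 1"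
    show "((E \<circ> l) has_vector_derivative z * (exp (of_real \<zeta> * l r) * F (l r))) (at r)"
      using dk[of r] r by (simp add: at_within_Icc_at)
    show "((\<lambda>r. A * exp (\<zeta> * Re z * r)) has_vector_derivative A * (\<zeta> * Re z * exp (\<zeta> * Re z * r))) (at r)"
      unfolding has_real_derivative_iff_has_vector_derivative[symmetric]
      by (auto intro!: derivative_eq_intros)
    have "norm (z * (exp (of_real \<zeta> * l r) * F (l r))) = norm z * norm (F (l r)) * exp (\<zeta> * Re z * r)"
      by (simp add: norm_mult l_def mult_ac)
    also have "\<dots> \<le> (Re z / c) * m * exp (\<zeta> * Re z * r)"
      using z c m F[OF lc[of r]] r Rez
      by (intro mult_mono mult_right_mono) (auto simp: ccone_def field_simps)
    also have "\<dots> = A * (\<zeta> * Re z * exp (\<zeta> * Re z * r))"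
      using c \<zeta> by (simp add: A_def)
    finally show "norm (z * (exp (of_real \<zeta> * l r) * F (l r))) \<le> A * (\<zeta> * Re z * exp (\<zeta> * Re z * r))" .
  qed simp
  then have "norm (E z - u 0) \<le> A * exp (\<zeta> * Re z) - A"
    by (simp add: l_def E_def)
  then have "norm (E z) \<le> norm (u 0) + A * exp (\<zeta> * Re z)"
    using norm_triangle_ineq2[of "E z" "u 0"] A by linarith
  moreover have "norm (E z) = exp (\<zeta> * Re z) * norm (u z)"
    by (simp add: E_def norm_mult)
  moreover have "norm (u 0) \<le> norm (u 0) * exp (\<zeta> * Re z)"
    using \<zeta> Rez by (simp add: mult_le_cancel_left1)
  ultimately have "exp (\<zeta> * Re z) * norm (u z) \<le> exp (\<zeta> * Re z) * (norm (u 0) + A)"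
    by (simp add: algebra_simps)
  then show ?thesis by (simp add: A_def)
qed

text \<open>Variation of constants, with a primitive of \<open>exp (\<zeta> * z) * F z\<close>.
  Solving on the whole plane keeps each solution differentiable everywhere, so that it can serve as
  forcing in the next equation.\<close>

lemma entire_ode_solution:
  fixes F :: "complex \<Rightarrow> complex"
  assumes "\<And>z. F field_differentiable at z"
  shows "\<exists>u. u 0 = 0 \<and> (\<forall>z. (u has_field_derivative (- \<zeta> * u z + F z)) (at z))"
proof -
  have "F holomorphic_on UNIV"
    using assms by (simp add: holomorphic_on_def field_differentiable_at_within)
  then have "(\<lambda>z. exp (\<zeta> * z) * F z) holomorphic_on UNIV"
    by (intro holomorphic_intros)
  then obtain P where P: "\<And>x. (P has_field_derivative exp (\<zeta> * x) * F x) (at x)"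
    using holomorphic_convex_primitive'[of UNIV "\<lambda>z. exp (\<zeta> * z) * F z"] by auto
  define u where "u z = exp (- \<zeta> * z) * (P z - P 0)" for z
  have "(u has_field_derivative (- \<zeta> * u z + F z)) (at z)" for z
    unfolding u_def by (rule derivative_eq_intros P refl | simp add: algebra_simps flip: exp_add)+
  moreover have "u 0 = 0" by (simp add: u_def)
  ultimately show ?thesis by blast
qed

text \<open>After multiplication by \<open>exp (\<zeta> * v)\<close> the derivative along the
  half-line is a nonnegative real: the real part grows from 0, and the imaginary part is monotone in
  both directions, hence 0.\<close>

lemma ode_solution_nonneg_Reals:
  fixes u F :: "complex \<Rightarrow> complex" and \<zeta> :: real
  assumes der: "\<And>z. (u has_field_derivative (- of_real \<zeta> * u z + F z)) (at z)"
    and u0: "u 0 = 0" and F: "\<And>t. 0 \<le> t \<Longrightarrow> F (of_real t) \<in> \<real>\<^sub>\<ge>\<^sub>0" and t: "0 \<le> t"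
  shows "u (of_real t) \<in> \<real>\<^sub>\<ge>\<^sub>0"
proof -
  define E where "E v = exp (of_real \<zeta> * v) * u v" for v
  have "(E has_field_derivative exp (of_real \<zeta> * v) * F v) (at v)" for v
    unfolding E_def by (rule derivative_eq_intros der refl | simp add: algebra_simps)+
  then have E: "((\<lambda>x. E (of_real x)) has_vector_derivative exp (of_real \<zeta> * of_real x) * F (of_real x)) (at x)" for x
    by (intro has_vector_derivative_real_field)
  have eq: "exp (of_real \<zeta> * of_real x) = complex_of_real (exp (\<zeta> * x))" for x
    by (simp flip: exp_of_real)
  have re: "((\<lambda>x. Re (E (of_real x))) has_field_derivative exp (\<zeta> * x) * Re (F (of_real x))) (at x)" for x
    using has_field_derivative_Re[OF E[of x]] unfolding eq by simp
  have im: "((\<lambda>x. Im (E (of_real x))) has_field_derivative exp (\<zeta> * x) * Im (F (of_real x))) (at x)" for x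
    using has_field_derivative_Im[OF E[of x]] unfolding eq by simp
  have "Re (E (of_real 0)) \<le> Re (E (of_real t))"
    by (rule DERIV_nonneg_imp_nondecreasing[OF t]) (use re F in \<open>force simp: complex_nonneg_Reals_iff\<close>)
  moreover have "Im (E (of_real 0)) \<le> Im (E (of_real t))"
    by (rule DERIV_nonneg_imp_nondecreasing[OF t]) (use im F in \<open>force simp: complex_nonneg_Reals_iff\<close>)
  moreover have "Im (E (of_real t)) \<le> Im (E (of_real 0))"
    by (rule DERIV_nonpos_imp_nonincreasing[OF t]) (use im F in \<open>force simp: complex_nonneg_Reals_iff\<close>)
  ultimately have "0 \<le> Re (E (of_real t))" "Im (E (of_real t)) = 0"
    by (auto simp: E_def u0)
  then show ?thesis
    unfolding E_def eq by (simp add: complex_nonneg_Reals_iff zero_le_mult_iff)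
qed

subsection \<open>The backward equation\<close>

text \<open>\<open>B k j\<close> is the rate from \<open>j\<close> to \<open>k\<close>: jumps go up
  by at most one and down arbitrarily far, so columns are finite while rows may be infinite. The
  weight stays abstract, since all that matters about it is nonnegativity and
  \<open>B_col\<close>.\<close>

locale kolmogorov =
  fixes w \<theta> :: "nat \<Rightarrow> real" and B :: "nat \<Rightarrow> nat \<Rightarrow> real" and \<kappa> c \<omega> :: real
  assumes w_nonneg: "\<And>j. 0 \<le> w j" and \<theta>_nonneg: "\<And>j. 0 \<le> \<theta> j" and \<omega>_pos: "0 < \<omega>"
    and B_nonneg: "\<And>k j. 0 \<le> B k j" and B_upper: "\<And>k j. j + 1 < k \<Longrightarrow> B k j = 0"
    and B_col: "\<And>j. (\<Sum>k\<le>j+1. w k * B k j) \<le> \<kappa> * (\<theta> j + \<omega>) * w j"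
    and \<kappa>c: "0 \<le> \<kappa>" "\<kappa> < c" "c < 1"
begin

text \<open>Contraction factor of one Dyson step: applying \<open>BT\<close> costs
  \<open>\<kappa> * \<zeta> j\<close>, and solving the scalar equation on the cone gives back
  \<open>1 / (c * \<zeta> j)\<close>.\<close>

definition "q = \<kappa> / c"

lemma c_pos: "0 < c" using \<kappa>c by simp
lemma q: "0 \<le> q" "q < 1" using \<kappa>c by (auto simp: q_def)

definition "\<zeta> j = \<theta> j + \<omega>"

lemma \<zeta>_pos: "0 < \<zeta> j"
  using \<theta>_nonneg[of j] \<omega>_pos by (simp add: \<zeta>_def)

definition BT :: "(nat \<Rightarrow> complex) \<Rightarrow> nat \<Rightarrow> complex" where
  "BT \<phi> j = (\<Sum>k\<le>j+1. of_real (B k j) * \<phi> k)"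

lemma BT_bound:
  assumes "\<And>k. norm (\<phi> k) \<le> C * w k" "0 \<le> C"
  shows "norm (BT \<phi> j) \<le> C * (\<kappa> * \<zeta> j * w j)"
proof -
  have "norm (BT \<phi> j) \<le> (\<Sum>k\<le>j+1. norm (of_real (B k j) * \<phi> k))"
    unfolding BT_def by (rule norm_sum)
  also have "\<dots> \<le> (\<Sum>k\<le>j+1. C * (w k * B k j))"
    using mult_left_mono[OF assms(1) B_nonneg]
    by (intro sum_mono) (auto simp: norm_mult B_nonneg mult_ac)
  also have "\<dots> \<le> C * (\<kappa> * \<zeta> j * w j)"
    using B_col[of j] assms(2) unfolding sum_distrib_left[symmetric] \<zeta>_def by (rule mult_left_mono)
  finally show ?thesis .
qed

lemma BT_linear: "BT (\<lambda>k. a * \<phi> k + b * \<psi> k) j = a * BT \<phi> j + b * BT \<psi> j"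
  by (simp add: BT_def sum_distrib_left sum.distrib algebra_simps)

text \<open>The \<open>n\<close>-th Dyson-Phillips term; the equation defining it for \<open>Suc n\<close> is uniquely solvable by entire functions.\<close>
primrec dys :: "(nat \<Rightarrow> complex) \<Rightarrow> nat \<Rightarrow> nat \<Rightarrow> complex \<Rightarrow> complex" where
  "dys \<phi> 0 = (\<lambda>j z. \<phi> j * exp (- of_real (\<zeta> j) * z))"
| "dys \<phi> (Suc n) = (\<lambda>j. SOME u. u 0 = 0 \<and>
     (\<forall>z. (u has_field_derivative (- of_real (\<zeta> j) * u z + BT (\<lambda>k. dys \<phi> n k z) j)) (at z)))"

text \<open>The choice in \<open>dys\<close> is justified only if its forcing is entire, which
  depends on the choice made one level below. Differentiability is therefore carried through an
  induction that unfolds the choice at every level.\<close>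

lemma dys_Suc_0: "dys \<phi> (Suc n) j 0 = 0"
  and dys_Suc_deriv: "(dys \<phi> (Suc n) j has_field_derivative
     (- of_real (\<zeta> j) * dys \<phi> (Suc n) j z + BT (\<lambda>k. dys \<phi> n k z) j)) (at z)"
proof -
  have *: "\<exists>u. u 0 = 0 \<and>
     (\<forall>z. (u has_field_derivative (- of_real (\<zeta> j) * u z + BT (\<lambda>k. dys \<phi> n k z) j)) (at z))"
    if "\<And>k z. dys \<phi> n k field_differentiable at z" for n j
    unfolding BT_def
    by (intro entire_ode_solution field_differentiable_sum field_differentiable_mult
        field_differentiable_const that)
  have fd: "dys \<phi> n j field_differentiable at z" for n j z
  proof (induction n arbitrary: j z)
    case 0
    have "((\<lambda>z. \<phi> j * exp (- of_real (\<zeta> j) * z)) has_field_derivative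
        \<phi> j * (exp (- of_real (\<zeta> j) * z) * (- of_real (\<zeta> j)))) (at z)"
      by (auto intro!: derivative_eq_intros)
    then show ?case by (auto simp: field_differentiable_def)
  next
    case (Suc n)
    from someI_ex[OF *[of n j, OF Suc]] show ?case
      by (auto simp: field_differentiable_def)
  qed
  from someI_ex[OF *[of n j, OF fd]]
  show "dys \<phi> (Suc n) j 0 = 0" "(dys \<phi> (Suc n) j has_field_derivative
     (- of_real (\<zeta> j) * dys \<phi> (Suc n) j z + BT (\<lambda>k. dys \<phi> n k z) j)) (at z)"
    by auto
qed

declare dys.simps(2) [simp del]

text \<open>The rate \<open>\<zeta> j\<close> in the forcing cancels against the decay rate of the
  equation, so the gain \<open>q\<close> is the same for all \<open>j\<close> although the rates may
  be unbounded.\<close>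

lemma cone_ode_bound':
  assumes "\<And>z. z \<in> ccone c \<Longrightarrow> (u has_field_derivative (- of_real (\<zeta> j) * u z + F z)) (at z within ccone c)"
    and "\<And>z. z \<in> ccone c \<Longrightarrow> norm (F z) \<le> C * (\<kappa> * \<zeta> j * w j)"
    and "u 0 = 0" "z \<in> ccone c"
  shows "norm (u z) \<le> C * q * w j"
  using cone_ode_bound[OF c_pos \<zeta>_pos assms(1,2,4)] \<zeta>_pos[of j] c_pos
  by (simp add: assms(3) q_def field_simps)

lemma dys_bound:
  assumes \<phi>: "\<And>k. norm (\<phi> k) \<le> C * w k" "0 \<le> C" and z: "z \<in> ccone c"
  shows "norm (dys \<phi> n j z) \<le> C * q ^ n * w j"
  using z
proof (induction n arbitrary: j z)
  case 0
  have "0 \<le> c * norm z" using c_pos by simp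
  then have "0 \<le> Re z" using 0 unfolding ccone_def by simp
  then have "norm (exp (- of_real (\<zeta> j) * z)) \<le> 1"
    using \<zeta>_pos[of j] by simp
  then have "norm (\<phi> j) * norm (exp (- of_real (\<zeta> j) * z)) \<le> norm (\<phi> j) * 1"
    by (intro mult_left_mono) auto
  then show ?case using \<phi>(1)[of j] by (simp add: norm_mult)
next
  case (Suc n)
  have "norm (dys \<phi> (Suc n) j z) \<le> C * q ^ n * q * w j"
  proof (rule cone_ode_bound'[where u = "dys \<phi> (Suc n) j" and F = "\<lambda>z. BT (\<lambda>k. dys \<phi> n k z) j", OF _ _ dys_Suc_0 Suc.prems])
    show "(dys \<phi> (Suc n) j has_field_derivative
       (- of_real (\<zeta> j) * dys \<phi> (Suc n) j z + BT (\<lambda>k. dys \<phi> n k z) j)) (at z within ccone c)" for z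
      by (rule has_field_derivative_at_within[OF dys_Suc_deriv])
    show "norm (BT (\<lambda>k. dys \<phi> n k z) j) \<le> C * q ^ n * (\<kappa> * \<zeta> j * w j)" if "z \<in> ccone c" for z
      using Suc.IH[OF that] q \<phi>(2) by (intro BT_bound) auto
  qed
  then show ?case by (simp add: mult_ac)
qed

section \<open>Sum of the Dyson-Phillips series: equation, uniqueness, semigroup law\<close>

definition V :: "(nat \<Rightarrow> complex) \<Rightarrow> complex \<Rightarrow> nat \<Rightarrow> complex" where
  "V \<phi> z j = (\<Sum>n. dys \<phi> n j z)"

lemma geometric_w: "(\<lambda>n. C * q ^ n * w j) sums (C / (1 - q) * w j)"
  using sums_mult2[OF sums_mult[OF geometric_sums[of q], of C], of "w j"] q by simp

lemma dys_summable:
  assumes "\<And>k. norm (\<phi> k) \<le> C * w k" "0 \<le> C" "z \<in> ccone c"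
  shows "summable (\<lambda>n. norm (dys \<phi> n j z))"
  by (rule summable_comparison_test'[of "\<lambda>n. C * q ^ n * w j" 0, OF sums_summable[OF geometric_w]])
    (use dys_bound[OF assms] in simp)

lemma V_bound:
  assumes "\<And>k. norm (\<phi> k) \<le> C * w k" "0 \<le> C" "z \<in> ccone c"
  shows "norm (V \<phi> z j) \<le> C / (1 - q) * w j"
proof -
  have "norm (V \<phi> z j) \<le> (\<Sum>n. norm (dys \<phi> n j z))"
    unfolding V_def by (rule summable_norm[OF dys_summable[OF assms]])
  also have "\<dots> \<le> (\<Sum>n. C * q ^ n * w j)"
    by (intro suminf_le dys_bound[OF assms] dys_summable[OF assms] sums_summable[OF geometric_w])
  also have "\<dots> = C / (1 - q) * w j"
    by (rule sums_unique[OF geometric_w, symmetric])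
  finally show ?thesis .
qed

lemma V_0: "V \<phi> 0 j = \<phi> j"
proof -
  have "dys \<phi> n j 0 = (if n = 0 then \<phi> j else 0)" for n
    by (cases n) (simp_all only: dys_Suc_0, simp_all)
  then have "(\<lambda>n. dys \<phi> n j 0) sums \<phi> j"
    using sums_single[of 0 "\<lambda>_. \<phi> j"] by simp
  then show ?thesis
    unfolding V_def by (rule sums_unique[symmetric])
qed

text \<open>Termwise differentiation by the Weierstrass test: the derivatives of the terms decay
  geometrically, uniformly on the cone. The bound contains \<open>\<zeta> j\<close>, which is
  harmless because \<open>j\<close> is fixed.\<close>

lemma V_deriv:
  assumes \<phi>: "\<And>k. norm (\<phi> k) \<le> C * w k" "0 \<le> C" and z: "z \<in> ccone c"
  shows "((\<lambda>z. V \<phi> z j) has_field_derivative (- of_real (\<zeta> j) * V \<phi> z j + BT (V \<phi> z) j)) (at z within ccone c)"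
proof -
  define f' where "f' n z = - of_real (\<zeta> j) * dys \<phi> n j z + (case n of 0 \<Rightarrow> 0 | Suc m \<Rightarrow> BT (\<lambda>k. dys \<phi> m k z) j)" for n z
  have d0: "(dys \<phi> 0 j has_field_derivative f' 0 z) (at z)" for z
    unfolding f'_def by (auto intro!: derivative_eq_intros)
  have d: "(dys \<phi> n j has_field_derivative f' n z) (at z within ccone c)" for n z
  proof (cases n)
    case 0
    then show ?thesis using has_field_derivative_at_within[OF d0] by simp
  next
    case (Suc m)
    then show ?thesis using has_field_derivative_at_within[OF dys_Suc_deriv[of \<phi> m j z]] by (simp add: f'_def)
  qed
  have bd: "norm (f' n z) \<le> (\<zeta> j * C + C * c * \<zeta> j) * q ^ n * w j" if "z \<in> ccone c" for n z
  proof -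
    have 1: "norm (- of_real (\<zeta> j) * dys \<phi> n j z) \<le> \<zeta> j * (C * q ^ n * w j)"
      using mult_left_mono[OF dys_bound[OF \<phi> that, of n j] less_imp_le[OF \<zeta>_pos[of j]]] \<zeta>_pos[of j]
      by (simp add: norm_mult)
    have 2: "norm (case n of 0 \<Rightarrow> 0 | Suc m \<Rightarrow> BT (\<lambda>k. dys \<phi> m k z) j) \<le> C * c * \<zeta> j * q ^ n * w j"
    proof (cases n)
      case 0
      then show ?thesis using \<phi>(2) c_pos \<zeta>_pos[of j] w_nonneg[of j] by simp
    next
      case (Suc m)
      have "norm (BT (\<lambda>k. dys \<phi> m k z) j) \<le> C * q ^ m * (\<kappa> * \<zeta> j * w j)"
        using dys_bound[OF \<phi> that] q \<phi>(2) by (intro BT_bound) auto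
      \<comment> \<open>Writing \<open>\<kappa>\<close> as \<open>c * q\<close> recovers the power
        \<open>q ^ n\<close> with \<open>n = Suc m\<close>, although the forcing only involves the
        term of index \<open>m\<close>.\<close>
      also have "\<dots> = C * q ^ m * (c * q * \<zeta> j * w j)" using c_pos by (simp add: q_def)
      finally show ?thesis using Suc by (simp add: mult_ac)
    qed
    show ?thesis
      unfolding f'_def by (rule order_trans[OF norm_triangle_mono[OF 1 2]]) (simp add: algebra_simps)
  qed
  have "uniform_limit (ccone c) (\<lambda>n x. \<Sum>i<n. f' i x) (\<lambda>x. \<Sum>i. f' i x) sequentially"
    by (rule Weierstrass_m_test[OF bd sums_summable[OF geometric_w]])
  then obtain g where g: "\<And>x. x \<in> ccone c \<Longrightarrow> (\<lambda>n. dys \<phi> n j x) sums g x \<and> (g has_field_derivative (\<Sum>i. f' i x)) (at x within ccone c)"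
    using has_field_derivative_series[of "ccone c" "\<lambda>n. dys \<phi> n j" f' _ 0, OF convex_ccone d]
      c_pos summable_norm_cancel[OF dys_summable[OF \<phi>, of 0 j]] by force
  have "V \<phi> x j = g x" if "x \<in> ccone c" for x
    using g[OF that] by (auto simp: V_def dest: sums_unique)
  moreover have "(\<Sum>i. f' i z) = - of_real (\<zeta> j) * V \<phi> z j + BT (V \<phi> z) j"
  proof -
    have s: "(\<lambda>n. dys \<phi> n k z) sums V \<phi> z k" for k
      unfolding V_def by (rule summable_sums[OF summable_norm_cancel[OF dys_summable[OF \<phi> z]]])
    have "(\<lambda>m. BT (\<lambda>k. dys \<phi> m k z) j) sums BT (V \<phi> z) j"
      unfolding BT_def by (intro sums_sum sums_mult s)
    then have "(\<lambda>n. case n of 0 \<Rightarrow> 0 | Suc m \<Rightarrow> BT (\<lambda>k. dys \<phi> m k z) j) sums BT (V \<phi> z) j"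
      using sums_Suc[of "\<lambda>n. case n of 0 \<Rightarrow> 0 | Suc m \<Rightarrow> BT (\<lambda>k. dys \<phi> m k z) j"] by simp
    then have "(\<lambda>n. f' n z) sums (- of_real (\<zeta> j) * V \<phi> z j + BT (V \<phi> z) j)"
      unfolding f'_def by (intro sums_add sums_mult s)
    then show ?thesis by (rule sums_unique[symmetric])
  qed
  ultimately show ?thesis
    using g[OF z] z has_derivative_transform[of z "ccone c" "\<lambda>z. V \<phi> z j" g]
    unfolding has_field_derivative_def by auto
qed

text \<open>A bound \<open>C * w j\<close> on the solution gives a bound on its own forcing, and the
  scalar estimate returns \<open>C * q * w j\<close>. Iterating drives the bound to 0.\<close>

lemma ode_unique:
  assumes b: "\<And>j z. z \<in> ccone c \<Longrightarrow> norm (U j z) \<le> C * w j" and C: "0 \<le> C"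
    and der: "\<And>j z. z \<in> ccone c \<Longrightarrow> (U j has_field_derivative (- of_real (\<zeta> j) * U j z + BT (\<lambda>k. U k z) j)) (at z within ccone c)"
    and 0: "\<And>j. U j 0 = 0" and z: "z \<in> ccone c"
  shows "U j z = 0"
proof -
  have "norm (U j z) \<le> C * q ^ n * w j" for n
    using z
  proof (induction n arbitrary: j z)
    case 0
    then show ?case using b by simp
  next
    case (Suc n)
    have "norm (U j z) \<le> C * q ^ n * q * w j"
      using Suc.IH q C
      by (intro cone_ode_bound'[OF der _ 0 Suc.prems] BT_bound) auto
    then show ?case by (simp add: mult_ac)
  qed
  moreover have "(\<lambda>n. C * q ^ n * w j) \<longlonglongrightarrow> 0"
    by (rule summable_LIMSEQ_zero[OF sums_summable[OF geometric_w]])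
  ultimately have "norm (U j z) \<le> 0"
    by (intro LIMSEQ_le_const) auto
  then show ?thesis by simp
qed

text \<open>The working form of uniqueness: a bounded solution is \<open>V\<close> of its own
  initial value. Linearity and the semigroup law then only require exhibiting a solution.\<close>

lemma ode_unique_V:
  assumes b: "\<And>j z. z \<in> ccone c \<Longrightarrow> norm (U j z) \<le> C * w j" and C: "0 \<le> C"
    and der: "\<And>j z. z \<in> ccone c \<Longrightarrow> (U j has_field_derivative (- of_real (\<zeta> j) * U j z + BT (\<lambda>k. U k z) j)) (at z within ccone c)"
    and z: "z \<in> ccone c"
  shows "U j z = V (\<lambda>k. U k 0) z j"
proof -
  note b0 = b[OF zero_in_ccone]
  have "U j z - V (\<lambda>k. U k 0) z j = 0"
  proof (rule ode_unique[where U = "\<lambda>j z. U j z - V (\<lambda>k. U k 0) z j" and C = "C + C / (1 - q)"])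
    fix j z assume z: "z \<in> ccone c"
    show "norm (U j z - V (\<lambda>k. U k 0) z j) \<le> (C + C / (1 - q)) * w j"
      using b[OF z, of j] V_bound[OF b0 C z, of j] norm_triangle_ineq4[of "U j z" "V (\<lambda>k. U k 0) z j"]
      unfolding distrib_right by linarith
    show "((\<lambda>z. U j z - V (\<lambda>k. U k 0) z j) has_field_derivative - of_real (\<zeta> j) * (U j z - V (\<lambda>k. U k 0) z j) +
         BT (\<lambda>k. U k z - V (\<lambda>k. U k 0) z k) j) (at z within ccone c)"
    proof -
      have "BT (\<lambda>k. U k z - V (\<lambda>k. U k 0) z k) j = BT (\<lambda>k. U k z) j - BT (V (\<lambda>k. U k 0) z) j"
        using BT_linear[of 1 "\<lambda>k. U k z" "-1" "V (\<lambda>k. U k 0) z" j] by simp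
      then have "- of_real (\<zeta> j) * (U j z - V (\<lambda>k. U k 0) z j) + BT (\<lambda>k. U k z - V (\<lambda>k. U k 0) z k) j
          = (- of_real (\<zeta> j) * U j z + BT (\<lambda>k. U k z) j) - (- of_real (\<zeta> j) * V (\<lambda>k. U k 0) z j + BT (V (\<lambda>k. U k 0) z) j)"
        by (simp add: algebra_simps)
      then show ?thesis
        using DERIV_diff[OF der[OF z, of j] V_deriv[OF b0 C z, of j]] by simp
    qed
  qed (use C q z in \<open>auto simp: V_0\<close>)
  then show ?thesis by simp
qed

lemma V_linear:
  assumes \<phi>: "\<And>k. norm (\<phi> k) \<le> C * w k" "0 \<le> C" and \<psi>: "\<And>k. norm (\<psi> k) \<le> D * w k" "0 \<le> D"
    and z: "z \<in> ccone c"
  shows "V (\<lambda>k. a * \<phi> k + b * \<psi> k) z j = a * V \<phi> z j + b * V \<psi> z j"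
proof -
  have "a * V \<phi> z j + b * V \<psi> z j = V (\<lambda>k. a * V \<phi> 0 k + b * V \<psi> 0 k) z j"
  proof (rule ode_unique_V[where C = "norm a * (C / (1 - q)) + norm b * (D / (1 - q))" and U = "\<lambda>j z. a * V \<phi> z j + b * V \<psi> z j"])
    fix j z assume z: "z \<in> ccone c"
    have "norm (a * V \<phi> z j + b * V \<psi> z j) \<le> norm a * (C / (1 - q) * w j) + norm b * (D / (1 - q) * w j)"
      using V_bound[OF \<phi> z, of j] V_bound[OF \<psi> z, of j] unfolding norm_mult[symmetric]
      by (intro norm_triangle_mono) (simp_all only: norm_mult mult_left_mono norm_ge_zero)
    then show "norm (a * V \<phi> z j + b * V \<psi> z j) \<le> (norm a * (C / (1 - q)) + norm b * (D / (1 - q))) * w j"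
      by (simp add: algebra_simps)
    show "((\<lambda>z. a * V \<phi> z j + b * V \<psi> z j) has_field_derivative - of_real (\<zeta> j) * (a * V \<phi> z j + b * V \<psi> z j) +
         BT (\<lambda>k. a * V \<phi> z k + b * V \<psi> z k) j) (at z within ccone c)"
      using DERIV_add[OF DERIV_cmult[OF V_deriv[OF \<phi> z, of j], of a] DERIV_cmult[OF V_deriv[OF \<psi> z, of j], of b]]
      by (simp add: BT_linear algebra_simps)
  qed (use \<phi>(2) \<psi>(2) q z in auto)
  then show ?thesis by (simp add: V_0)
qed

lemma V_semigroup:
  assumes \<phi>: "\<And>k. norm (\<phi> k) \<le> C * w k" "0 \<le> C" and s: "s \<in> ccone c" and z: "z \<in> ccone c"
  shows "V (V \<phi> s) z j = V \<phi> (s + z) j"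
proof -
  have sz: "s + z \<in> ccone c" if "z \<in> ccone c" for z
    using ccone_add[OF _ s that] c_pos by simp
  have "V \<phi> (s + z) j = V (\<lambda>k. V \<phi> (s + 0) k) z j"
  proof (rule ode_unique_V[where C = "C / (1 - q)" and U = "\<lambda>j z. V \<phi> (s + z) j", OF _ _ _ z])
    fix j z assume z: "z \<in> ccone c"
    show "norm (V \<phi> (s + z) j) \<le> C / (1 - q) * w j"
      by (rule V_bound[OF \<phi> sz[OF z]])
    \<comment> \<open>Translation by \<open>s\<close> maps the cone into itself, so the derivative
      within the cone restricts to the translated cone.\<close>
    have "((\<lambda>z. V \<phi> z j) \<circ> (+) s has_field_derivative (- of_real (\<zeta> j) * V \<phi> (s + z) j +
         BT (V \<phi> (s + z)) j) * 1) (at z within ccone c)"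
      using sz by (intro DERIV_image_chain DERIV_subset[OF V_deriv[OF \<phi> sz[OF z]]])
        (auto intro!: derivative_eq_intros)
    then show "((\<lambda>z. V \<phi> (s + z) j) has_field_derivative - of_real (\<zeta> j) * V \<phi> (s + z) j +
         BT (\<lambda>k. V \<phi> (s + z) k) j) (at z within ccone c)"
      by (simp add: o_def)
  qed (use \<phi>(2) q in auto)
  then show ?thesis by simp
qed

text \<open>\<open>BT\<close> at \<open>j\<close> reads entries only up to \<open>j + 1\<close>, so
  each term uses up one row of the zeros of \<open>\<phi>\<close>. Zero forcing and zero initial
  value give the zero solution, through the scalar bound with constant 0.\<close>

lemma dys_finite_range:
  assumes "\<And>k. k \<le> N \<Longrightarrow> \<phi> k = 0" "n + j \<le> N" "z \<in> ccone c"
  shows "dys \<phi> n j z = 0"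
  using assms(2,3)
proof (induction n arbitrary: j z)
  case 0
  then show ?case using assms(1) by simp
next
  case (Suc n)
  have "norm (dys \<phi> (Suc n) j z) \<le> 0 * q * w j"
  proof (rule cone_ode_bound'[where u = "dys \<phi> (Suc n) j" and F = "\<lambda>z. BT (\<lambda>k. dys \<phi> n k z) j" and C = 0, OF _ _ dys_Suc_0 Suc.prems(2)])
    show "(dys \<phi> (Suc n) j has_field_derivative
       (- of_real (\<zeta> j) * dys \<phi> (Suc n) j z + BT (\<lambda>k. dys \<phi> n k z) j)) (at z within ccone c)" for z
      by (rule has_field_derivative_at_within[OF dys_Suc_deriv])
    show "norm (BT (\<lambda>k. dys \<phi> n k z) j) \<le> 0 * (\<kappa> * \<zeta> j * w j)" if "z \<in> ccone c" for z
      using Suc.IH[OF _ that] Suc.prems(1) by (simp add: BT_def)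
  qed
  then show ?case by simp
qed

text \<open>In row \<open>j\<close>, the \<open>n\<close>-th term only sees \<open>\<phi>\<^sub>k\<close> with \<open>k \<le> j + n\<close>; this replaces weak-* continuity of the dual semigroup.\<close>
lemma V_tail_bound:
  assumes \<phi>: "\<And>k. norm (\<phi> k) \<le> C * w k" "0 \<le> C" and z: "z \<in> ccone c"
    and 0: "\<And>k. k \<le> j + m \<Longrightarrow> \<phi> k = 0"
  shows "norm (V \<phi> z j) \<le> (C * q ^ m) / (1 - q) * w j"
proof -
  have "(\<Sum>n<m. dys \<phi> n j z) = 0"
    using dys_finite_range[OF 0 _ z] by (intro sum.neutral) auto
  then have "V \<phi> z j = (\<Sum>n. dys \<phi> (n + m) j z)"
    using suminf_split_initial_segment[OF summable_norm_cancel[OF dys_summable[OF \<phi> z, of j]], of m]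
    by (simp add: V_def)
  also have "norm \<dots> \<le> (\<Sum>n. norm (dys \<phi> (n + m) j z))"
    by (rule summable_norm) (subst summable_iff_shift, rule dys_summable[OF \<phi> z])
  also have "\<dots> \<le> (\<Sum>n. (C * q ^ m) * q ^ n * w j)"
  proof (intro suminf_le sums_summable[OF geometric_w])
    show "norm (dys \<phi> (n + m) j z) \<le> C * q ^ m * q ^ n * w j" for n
      using dys_bound[OF \<phi> z, of "n + m" j] by (simp add: power_add mult_ac)
    show "summable (\<lambda>n. norm (dys \<phi> (n + m) j z))"
      by (subst summable_iff_shift, rule dys_summable[OF \<phi> z])
  qed
  also have "\<dots> = (C * q ^ m) / (1 - q) * w j"
    by (rule sums_unique[OF geometric_w, symmetric])
  finally show ?thesis .
qed

lemma V_truncation: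
  assumes \<phi>: "\<And>k. norm (\<phi> k) \<le> C * w k" "0 \<le> C" and z: "z \<in> ccone c"
  shows "(\<lambda>N. V (\<lambda>k. if k \<le> N then \<phi> k else 0) z j) \<longlonglongrightarrow> V \<phi> z j"
\<comment> \<open>Shifting the index by \<open>j\<close> makes the truncation happen at
  \<open>m + j\<close>, which is the hypothesis of \<open>V_tail_bound\<close>.\<close>
proof (rule LIMSEQ_offset[where k = j], rule Lim_transform)
  show "(\<lambda>m. V \<phi> z j) \<longlonglongrightarrow> V \<phi> z j" by simp
  have *: "norm (V \<phi> z j - V (\<lambda>k. if k \<le> m + j then \<phi> k else 0) z j) \<le> (C * q ^ m) / (1 - q) * w j" for m
  proof -
    have t: "norm (if k \<le> m + j then \<phi> k else 0) \<le> C * w k" for k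
      using \<phi> w_nonneg by simp
    have "V \<phi> z j - V (\<lambda>k. if k \<le> m + j then \<phi> k else 0) z j
        = V (\<lambda>k. 1 * \<phi> k + (-1) * (if k \<le> m + j then \<phi> k else 0)) z j"
      by (subst V_linear[OF \<phi> t \<phi>(2) z]) simp
    also have "norm \<dots> \<le> (C * q ^ m) / (1 - q) * w j"
      using \<phi> w_nonneg by (intro V_tail_bound z) auto
    finally show ?thesis .
  qed
  have "(\<lambda>m. (C * q ^ m) / (1 - q) * w j) \<longlonglongrightarrow> 0"
    using summable_LIMSEQ_zero[OF sums_summable[OF geometric_w[of "C / (1 - q)" j]]] by (simp add: mult_ac)
  then show "(\<lambda>m. V (\<lambda>k. if k \<le> m + j then \<phi> k else 0) z j - V \<phi> z j) \<longlonglongrightarrow> 0"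
    by (rule Lim_null_comparison[rotated]) (use * in \<open>simp add: norm_minus_commute\<close>)
qed

lemma V_nonneg_Reals:
  assumes \<phi>: "\<And>k. \<phi> k \<in> \<real>\<^sub>\<ge>\<^sub>0" "\<And>k. norm (\<phi> k) \<le> C * w k" "0 \<le> C" and t: "0 \<le> t"
  shows "V \<phi> (of_real t) j \<in> \<real>\<^sub>\<ge>\<^sub>0"
proof -
  have d: "dys \<phi> n j (of_real t) \<in> \<real>\<^sub>\<ge>\<^sub>0" for n
    using t
  proof (induction n arbitrary: j t)
    case 0
    have "exp (- of_real (\<zeta> j) * of_real t) = complex_of_real (exp (- \<zeta> j * t))"
      by (simp flip: exp_of_real)
    then show ?case using \<phi>(1)[of j] by (simp add: complex_nonneg_Reals_iff)
  next
    case (Suc n)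
    show ?case
    proof (rule ode_solution_nonneg_Reals[OF dys_Suc_deriv dys_Suc_0 _ Suc.prems])
      fix t :: real assume "0 \<le> t"
      then show "BT (\<lambda>k. dys \<phi> n k (of_real t)) j \<in> \<real>\<^sub>\<ge>\<^sub>0"
        unfolding BT_def using Suc.IH B_nonneg
        by (auto simp: complex_nonneg_Reals_iff intro!: sum_nonneg add_nonneg_nonneg mult_nonneg_nonneg)
    qed
  qed
  have z: "of_real t \<in> ccone c" using of_real_in_ccone t \<kappa>c by simp
  have "(\<lambda>n. dys \<phi> n j (of_real t)) sums V \<phi> (of_real t) j"
    unfolding V_def by (rule summable_sums[OF summable_norm_cancel[OF dys_summable[OF \<phi>(2,3) z]]])
  then have "(\<lambda>N. \<Sum>n<N. dys \<phi> n j (of_real t)) \<longlonglongrightarrow> V \<phi> (of_real t) j"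
    by (simp add: sums_def)
  then show ?thesis
    by (rule Lim_in_closed_set[OF closed_nonneg_Reals_complex _ sequentially_bot, rotated])
      (use d in \<open>auto simp: complex_nonneg_Reals_iff intro!: always_eventually sum_nonneg\<close>)
qed

end

text \<open>The bounds depend on \<open>F\<close> only through \<open>K\<close>, so they hold for
  all test sequences of the duality argument at once. The radius \<open>3 * r\<close> leaves room
  for closed discs of radius \<open>r\<close> around every point of \<open>ball z0 r\<close>, on
  which Cauchy's inequality bounds the second derivative in Taylor's formula.\<close>

lemma holomorphic_difference_quotient_bound:
  fixes F :: "complex \<Rightarrow> complex"
  assumes F: "F holomorphic_on ball z0 (3 * r)" and r: "0 < r"
    and K: "\<And>z. z \<in> ball z0 (3 * r) \<Longrightarrow> norm (F z) \<le> K" and z: "norm (z - z0) < r"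
  shows "norm (deriv F z0) \<le> K / r"
    and "z \<noteq> z0 \<Longrightarrow> norm ((F z - F z0) / (z - z0) - deriv F z0) \<le> 2 * K / r\<^sup>2 * norm (z - z0)"
proof -
  have sub: "cball x r \<subseteq> ball z0 (3 * r)" if "x \<in> ball z0 r" for x
  proof
    fix y assume "y \<in> cball x r"
    then show "y \<in> ball z0 (3 * r)"
      using that r dist_triangle[of z0 y x] by auto
  qed
  have C: "norm ((deriv ^^ n) F x) \<le> fact n * K / r ^ n" if "x \<in> ball z0 r" for x n
  proof (rule Cauchy_inequality)
    show "F holomorphic_on ball x r" "continuous_on (cball x r) F"
      using sub[OF that] F holomorphic_on_imp_continuous_on
      by (meson ball_subset_cball holomorphic_on_subset order_trans continuous_on_subset)+
    show "norm (F y) \<le> K" if "norm (x - y) = r" for y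
      using sub[OF \<open>x \<in> ball z0 r\<close>] that by (intro K) (auto simp: dist_norm)
  qed fact
  show "norm (deriv F z0) \<le> K / r"
    using C[of z0 1] r by simp
  assume ne: "z \<noteq> z0"
  have hd: "((deriv ^^ i) F has_field_derivative (deriv ^^ Suc i) F x) (at x within ball z0 r)"
    if "x \<in> ball z0 r" for i x
  proof -
    have "x \<in> ball z0 (3 * r)" using that r by auto
    then have "(deriv ^^ i) F field_differentiable at x"
      using holomorphic_higher_deriv[OF F open_ball] holomorphic_on_imp_differentiable_at by blast
    then show ?thesis
      by (simp add: DERIV_deriv_iff_field_differentiable has_field_derivative_at_within)
  qed
  have "norm ((deriv ^^ 0) F z - (\<Sum>i\<le>1. (deriv ^^ i) F z0 * (z - z0) ^ i / fact i))
      \<le> (2 * K / r\<^sup>2) * norm (z - z0) ^ Suc 1 / fact 1"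
  proof (rule complex_Taylor[OF convex_ball[of z0 r], of 1 "\<lambda>i. (deriv ^^ i) F"])
    show "norm ((deriv ^^ Suc 1) F x) \<le> 2 * K / r\<^sup>2" if "x \<in> ball z0 r" for x
      using C[OF that, of 2] by (simp add: numeral_2_eq_2)
  qed (use z r hd in \<open>auto simp: dist_norm norm_minus_commute\<close>)
  then have "norm (F z - F z0 - deriv F z0 * (z - z0)) \<le> (2 * K / r\<^sup>2 * norm (z - z0)) * norm (z - z0)"
    by (simp add: algebra_simps power2_eq_square)
  moreover have "(F z - F z0) / (z - z0) - deriv F z0 = (F z - F z0 - deriv F z0 * (z - z0)) / (z - z0)"
    using ne by (simp add: field_simps)
  ultimately show "norm ((F z - F z0) / (z - z0) - deriv F z0) \<le> 2 * K / r\<^sup>2 * norm (z - z0)"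
    using ne by (simp add: norm_divide divide_le_eq)
qed

text \<open>Since \<open>0 powr p = 0\<close>, the index 0 has weight 0, and every sequence bounded
  by a multiple of the weight vanishes there.\<close>

locale weighted_kolmogorov = kolmogorov "\<lambda>j. real j powr p" \<theta> B \<kappa> c \<omega>
  for p :: real and \<theta> B \<kappa> c \<omega> +
  assumes B_0: "\<And>j. B 0 j = 0"
begin

text \<open>\<open>V\<close> solves the backward equation for the rates shifted by \<open>\<omega>\<close>; \<open>W\<close> undoes the shift.\<close>
definition W :: "(nat \<Rightarrow> complex) \<Rightarrow> complex \<Rightarrow> nat \<Rightarrow> complex" where
  "W \<phi> z j = exp (of_real \<omega> * z) * V \<phi> z j"

definition M :: "complex \<Rightarrow> real" where
  "M z = exp (\<omega> * Re z) / (1 - q)"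

lemma M_pos: "0 < M z"
  using q by (simp add: M_def)

lemma M_mono: "Re z \<le> Re s \<Longrightarrow> M z \<le> M s"
  using q \<omega>_pos by (simp add: M_def divide_right_mono)

lemma W_bound:
  assumes "\<And>k. norm (\<phi> k) \<le> C * real k powr p" "0 \<le> C" "z \<in> ccone c"
  shows "norm (W \<phi> z j) \<le> C * M z * real j powr p"
  using mult_left_mono[OF V_bound[OF assms, of j], of "exp (\<omega> * Re z)"]
  by (simp add: W_def M_def norm_mult mult_ac)

lemma W_0: "W \<phi> 0 j = \<phi> j"
  by (simp add: W_def V_0)

definition YT :: "(nat \<Rightarrow> complex) \<Rightarrow> nat \<Rightarrow> complex" where
  "YT \<phi> j = - of_real (\<theta> j) * \<phi> j + BT \<phi> j"

lemma BT_cmult: "BT (\<lambda>k. a * \<phi> k) j = a * BT \<phi> j"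
  using BT_linear[of a \<phi> 0 \<phi> j] by simp

lemma YT_bound:
  assumes "\<And>k. norm (\<phi> k) \<le> C * real k powr p" "0 \<le> C"
  shows "norm (YT \<phi> j) \<le> C * (2 * \<zeta> j * real j powr p)"
proof -
  have "norm (YT \<phi> j) \<le> norm (of_real (\<theta> j) * \<phi> j) + norm (BT \<phi> j)"
    unfolding YT_def using norm_triangle_ineq[of "- of_real (\<theta> j) * \<phi> j" "BT \<phi> j"] by simp
  also have "\<dots> \<le> \<zeta> j * (C * real j powr p) + C * (1 * \<zeta> j * real j powr p)"
  proof (rule add_mono)
    show "norm (of_real (\<theta> j) * \<phi> j) \<le> \<zeta> j * (C * real j powr p)"
      using assms(1)[of j] \<theta>_nonneg[of j] \<omega>_pos unfolding norm_mult \<zeta>_def by (intro mult_mono) auto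
    have "norm (BT \<phi> j) \<le> C * (\<kappa> * \<zeta> j * real j powr p)"
      by (rule BT_bound[OF assms])
    also have "\<dots> \<le> C * (1 * \<zeta> j * real j powr p)"
      using assms(2) \<kappa>c \<zeta>_pos[of j] by (intro mult_left_mono mult_right_mono) auto
    finally show "norm (BT \<phi> j) \<le> C * (1 * \<zeta> j * real j powr p)" .
  qed
  finally show ?thesis by (simp add: algebra_simps)
qed

lemma YT_linear: "YT (\<lambda>k. a * \<phi> k + b * \<psi> k) j = a * YT \<phi> j + b * YT \<psi> j"
  by (simp add: YT_def BT_linear algebra_simps)

lemma W_deriv:
  assumes "\<And>k. norm (\<phi> k) \<le> C * real k powr p" "0 \<le> C" "z \<in> ccone c"
  shows "((\<lambda>z. W \<phi> z j) has_field_derivative YT (W \<phi> z) j) (at z within ccone c)"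
proof -
  have "YT (W \<phi> z) j = exp (of_real \<omega> * z) * YT (V \<phi> z) j"
    unfolding YT_def W_def BT_cmult by (simp add: algebra_simps)
  then have eq: "YT (W \<phi> z) j = exp (of_real \<omega> * z) * (- of_real (\<zeta> j) * V \<phi> z j + BT (V \<phi> z) j)
      + exp (of_real \<omega> * z) * of_real \<omega> * V \<phi> z j"
    by (simp add: YT_def \<zeta>_def algebra_simps)
  show ?thesis
    unfolding W_def[abs_def] eq[unfolded W_def[abs_def]]
    by (rule derivative_eq_intros V_deriv[OF assms] refl | simp)+
qed

lemma W_linear:
  assumes "\<And>k. norm (\<phi> k) \<le> C * real k powr p" "0 \<le> C"
    and "\<And>k. norm (\<psi> k) \<le> D * real k powr p" "0 \<le> D" and "z \<in> ccone c"
  shows "W (\<lambda>k. a * \<phi> k + b * \<psi> k) z j = a * W \<phi> z j + b * W \<psi> z j"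
  using V_linear[OF assms] by (simp add: W_def algebra_simps)

lemma W_semigroup:
  assumes \<phi>: "\<And>k. norm (\<phi> k) \<le> C * real k powr p" "0 \<le> C" and s: "s \<in> ccone c" and z: "z \<in> ccone c"
  shows "W (W \<phi> s) z j = W \<phi> (s + z) j"
proof -
  have b: "norm (V \<phi> s k) \<le> C / (1 - q) * real k powr p" for k
    by (rule V_bound[OF \<phi> s])
  have "V (\<lambda>k. exp (of_real \<omega> * s) * V \<phi> s k) z j = exp (of_real \<omega> * s) * V (V \<phi> s) z j"
    using V_linear[OF b _ b _ z, of "exp (of_real \<omega> * s)" 0 j] \<phi>(2) q by simp
  then show ?thesis
    unfolding W_def using V_semigroup[OF \<phi> s z, of j] by (simp add: distrib_left exp_add)
qed

lemma W_truncation: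
  assumes "\<And>k. norm (\<phi> k) \<le> C * real k powr p" "0 \<le> C" "z \<in> ccone c"
  shows "(\<lambda>N. W (\<lambda>k. if k \<le> N then \<phi> k else 0) z j) \<longlonglongrightarrow> W \<phi> z j"
  unfolding W_def by (intro tendsto_mult_left V_truncation[OF assms])

subsection \<open>The transition matrices\<close>

definition unit :: "nat \<Rightarrow> nat \<Rightarrow> complex" where
  "unit i k = (if k = i then 1 else 0)"

lemma unit_bound: "i \<noteq> 0 \<Longrightarrow> norm (unit i k) \<le> (1 / real i powr p) * real k powr p"
  by (auto simp: unit_def)

text \<open>Row \<open>i\<close> is the backward solution started from the \<open>i\<close>-th unit
  sequence; by linearity, pairing a finitely supported \<open>\<phi>\<close> with column
  \<open>j\<close> gives \<open>W \<phi> z j\<close>. Row 0 needs a separate value because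
  \<open>unit 0\<close> is not bounded by a multiple of the weight.\<close>

definition TM :: "complex \<Rightarrow> nat \<Rightarrow> nat \<Rightarrow> complex" where
  "TM z i j = (if i = 0 then 0 else W (unit i) z j)"

lemma TM_truncated_pairing:
  assumes \<phi>: "\<And>k. norm (\<phi> k) \<le> C * real k powr p" "0 \<le> C" and z: "z \<in> ccone c"
  shows "(\<Sum>i\<le>N. \<phi> i * TM z i j) = W (\<lambda>k. if k \<le> N then \<phi> k else 0) z j"
proof (induction N)
  case 0
  have "\<phi> 0 = 0" using \<phi>(1)[of 0] by simp
  \<comment> \<open>The truncated sequence is bounded with constant 0, so \<open>W_bound\<close>
    makes its solution vanish.\<close>
  then have "norm (if k \<le> 0 then \<phi> k else 0) \<le> 0 * real k powr p" for k by simp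
  from W_bound[OF this _ z, of j] show ?case by (simp add: TM_def)
next
  case (Suc N)
  have t: "norm (if k \<le> N then \<phi> k else 0) \<le> C * real k powr p" for k
    using \<phi> by simp
  have "(\<lambda>k. if k \<le> Suc N then \<phi> k else 0)
      = (\<lambda>k. 1 * (if k \<le> N then \<phi> k else 0) + \<phi> (Suc N) * unit (Suc N) k)"
    by (auto simp: unit_def fun_eq_iff le_Suc_eq)
  then have "W (\<lambda>k. if k \<le> Suc N then \<phi> k else 0) z j
      = 1 * W (\<lambda>k. if k \<le> N then \<phi> k else 0) z j + \<phi> (Suc N) * W (unit (Suc N)) z j"
    using W_linear[OF t \<phi>(2) unit_bound[of "Suc N"] _ z, of 1 "\<phi> (Suc N)" j] by simp
  then show ?case using Suc by (simp add: TM_def)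
qed

lemma TM_pairing:
  assumes "\<And>k. norm (\<phi> k) \<le> C * real k powr p" "0 \<le> C" "z \<in> ccone c" "\<And>k. k > N \<Longrightarrow> \<phi> k = 0"
  shows "(\<Sum>i\<le>N. \<phi> i * TM z i j) = W \<phi> z j"
proof -
  have "(\<lambda>k. if k \<le> N then \<phi> k else 0) = \<phi>" using assms(4) by force
  then show ?thesis using TM_truncated_pairing[OF assms(1-3), of j N] by simp
qed

lemma idm_pairing:
  assumes "\<phi> 0 = 0" "\<And>k. k > N \<Longrightarrow> \<phi> k = 0"
  shows "(\<Sum>i\<le>N. \<phi> i * idm i j) = \<phi> j"
proof -
  have "(\<Sum>i\<le>N. \<phi> i * idm i j) = (\<Sum>i\<le>N. if i = j then \<phi> i else 0)"
    using assms(1) by (intro sum.cong) (auto simp: idm_def)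
  then show ?thesis using assms(2)[of j] by simp
qed

definition YM :: "nat \<Rightarrow> nat \<Rightarrow> real" where
  "YM i j = (if i = 0 then 0 else (if i = j then - \<theta> j else 0) + B i j)"

lemma YM_pairing:
  assumes "\<phi> 0 = 0" "\<And>k. k > N \<Longrightarrow> \<phi> k = 0"
  shows "(\<Sum>i\<le>N. \<phi> i * of_real (YM i j)) = YT \<phi> j"
proof -
  have "(\<Sum>i\<le>N. \<phi> i * of_real (YM i j))
      = (\<Sum>i\<le>N. (if i = j then - of_real (\<theta> j) * \<phi> i else 0) + of_real (B i j) * \<phi> i)"
    using assms(1) by (intro sum.cong) (auto simp: YM_def algebra_simps)
  also have "\<dots> = - of_real (\<theta> j) * \<phi> j + (\<Sum>i\<le>N. of_real (B i j) * \<phi> i)"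
    using assms(2)[of j] by (simp add: sum.distrib)
  \<comment> \<open>Both cut-offs are reached from the common range up to \<open>N + j + 1\<close>:
    \<open>\<phi>\<close> vanishes beyond \<open>N\<close>, column \<open>j\<close> of
    \<open>B\<close> beyond \<open>j + 1\<close>.\<close>
  also have "(\<Sum>i\<le>N. of_real (B i j) * \<phi> i) = (\<Sum>i\<le>N+j+1. of_real (B i j) * \<phi> i)"
    using assms(2) by (intro sum.mono_neutral_left) auto
  also have "\<dots> = BT \<phi> j"
    unfolding BT_def using B_upper by (intro sum.mono_neutral_right) auto
  finally show ?thesis by (simp add: YT_def)
qed

lemma TM_colbd: 
  assumes "z \<in> ccone c"
  shows "colbd p (TM z) (\<lambda>j. M z * real j powr p)"
proof (rule colbdI_dual)
  fix N j and \<phi> :: "nat \<Rightarrow> complex" assume \<phi>: "\<And>i. norm (\<phi> i) \<le> real i powr p" "\<And>i. i > N \<Longrightarrow> \<phi> i = 0"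
  have b: "norm (\<phi> i) \<le> 1 * real i powr p" for i using \<phi>(1) by simp
  show "norm (\<Sum>i\<le>N. \<phi> i * TM z i j) \<le> M z * real j powr p"
    using TM_pairing[OF b _ assms \<phi>(2), where j = j and N = N] W_bound[OF b _ assms, of j] by simp
qed (simp add: TM_def)

lemma YM_colbd: "colbd p YM (\<lambda>j. 2 * \<zeta> j * real j powr p)"
proof -
  have "colbd p (\<lambda>i j. complex_of_real (YM i j)) (\<lambda>j. 2 * \<zeta> j * real j powr p)"
  proof (rule colbdI_dual)
    fix N j and \<phi> :: "nat \<Rightarrow> complex" assume \<phi>: "\<And>i. norm (\<phi> i) \<le> real i powr p" "\<And>i. i > N \<Longrightarrow> \<phi> i = 0"
    have b: "norm (\<phi> i) \<le> 1 * real i powr p" for i using \<phi>(1) by simp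
    have "\<phi> 0 = 0" using \<phi>(1)[of 0] by simp
    then show "norm (\<Sum>i\<le>N. \<phi> i * of_real (YM i j)) \<le> 2 * \<zeta> j * real j powr p"
      using YM_pairing[OF _ \<phi>(2)] YT_bound[OF b, of j] by simp
  qed (simp add: YM_def)
  from colbd_Re[OF this] show ?thesis by simp
qed

section \<open>Small-time estimates for the backward solutions\<close>

definition K :: real where "K = M 1"

lemma unit_cball_Re: "norm z \<le> 1 \<Longrightarrow> Re z \<le> Re 1"
  using complex_Re_le_cmod[of z] by simp

lemma K_pos: "0 < K" by (simp add: K_def M_pos)

lemma W_bound_unit:
  assumes "\<And>k. norm (\<phi> k) \<le> real k powr p" "z \<in> ccone c" "norm z \<le> 1"
  shows "norm (W \<phi> z j) \<le> K * real j powr p"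
proof -
  have "norm (W \<phi> z j) \<le> 1 * M z * real j powr p"
    using assms by (intro W_bound) auto
  also have "\<dots> \<le> K * real j powr p"
    using M_mono[OF unit_cball_Re[OF assms(3)]] by (simp add: K_def mult_right_mono)
  finally show ?thesis .
qed

lemma convex_ccone_cball: "convex (ccone c \<inter> cball 0 r)"
  using convex_ccone c_pos by (intro convex_Int) auto

text \<open>Mean value inequality on a convex piece of the cone. The constant grows with
  \<open>\<zeta> j\<close>, so by itself this controls each column but not all columns
  uniformly.\<close>

lemma W_diff_bound:
  assumes \<phi>: "\<And>k. norm (\<phi> k) \<le> real k powr p" and z: "z \<in> ccone c" "norm z \<le> 1"
  shows "norm (W \<phi> z j - \<phi> j) \<le> K * (2 * \<zeta> j * real j powr p) * norm z"
proof -
  have b: "norm (\<phi> k) \<le> 1 * real k powr p" for k using \<phi> by simp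
  have "norm (W \<phi> z j - W \<phi> 0 j) \<le> K * (2 * \<zeta> j * real j powr p) * norm (z - 0)"
  proof (rule field_differentiable_bound[OF convex_ccone_cball[of 1], where f' = "\<lambda>z. YT (W \<phi> z) j"])
    fix x assume x: "x \<in> ccone c \<inter> cball 0 1"
    then show "((\<lambda>z. W \<phi> z j) has_field_derivative YT (W \<phi> x) j) (at x within ccone c \<inter> cball 0 1)"
      by (intro DERIV_subset[OF W_deriv[OF b]]) auto
    show "norm (YT (W \<phi> x) j) \<le> K * (2 * \<zeta> j * real j powr p)"
      using x K_pos by (intro YT_bound W_bound_unit \<phi>) auto
  qed (use z in auto)
  then show ?thesis by (simp add: W_0)
qed

text \<open>Lipschitz constant of the derivative of \<open>W \<phi> z j\<close> at
  \<open>z = 0\<close>, obtained by feeding \<open>W_diff_bound\<close> into \<open>YT\<close>. It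
  is finite because column \<open>j\<close> of \<open>B\<close> is; its growth in \<open>j\<close>
  is left uncontrolled, since dominated convergence needs it for one \<open>j\<close> at a
  time.\<close>

definition R :: "nat \<Rightarrow> real" where
  "R j = \<theta> j * (K * (2 * \<zeta> j * real j powr p)) + (\<Sum>k\<le>j+1. B k j * (K * (2 * \<zeta> k * real k powr p)))"

lemma W_diff2_bound:
  assumes \<phi>: "\<And>k. norm (\<phi> k) \<le> real k powr p" and z: "z \<in> ccone c" "norm z \<le> 1"
  shows "norm (W \<phi> z j - \<phi> j - z * YT \<phi> j) \<le> R j * (norm z)\<^sup>2"
proof -
  have b: "norm (\<phi> k) \<le> 1 * real k powr p" for k using \<phi> by simp
  have R0: "0 \<le> R j"
    unfolding R_def using \<theta>_nonneg K_pos \<zeta>_pos B_nonneg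
    by (intro add_nonneg_nonneg mult_nonneg_nonneg sum_nonneg) (auto simp: less_imp_le)
  have d: "norm (YT (W \<phi> x) j - YT \<phi> j) \<le> R j * norm x" if "x \<in> ccone c" "norm x \<le> 1" for x
  proof -
    have "YT (W \<phi> x) j - YT \<phi> j = YT (\<lambda>k. W \<phi> x k - \<phi> k) j"
      using YT_linear[of 1 "W \<phi> x" "-1" \<phi> j] by simp
    also have "norm \<dots> \<le> norm (of_real (\<theta> j) * (W \<phi> x j - \<phi> j)) + norm (BT (\<lambda>k. W \<phi> x k - \<phi> k) j)"
      unfolding YT_def using norm_triangle_ineq[of "- of_real (\<theta> j) * (W \<phi> x j - \<phi> j)"] by simp
    also have "\<dots> \<le> \<theta> j * (K * (2 * \<zeta> j * real j powr p) * norm x)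
        + (\<Sum>k\<le>j+1. B k j * (K * (2 * \<zeta> k * real k powr p) * norm x))"
    proof (rule add_mono)
      show "norm (of_real (\<theta> j) * (W \<phi> x j - \<phi> j)) \<le> \<theta> j * (K * (2 * \<zeta> j * real j powr p) * norm x)"
        using W_diff_bound[OF \<phi> that, of j] \<theta>_nonneg[of j] unfolding norm_mult by (intro mult_mono) auto
      show "norm (BT (\<lambda>k. W \<phi> x k - \<phi> k) j) \<le> (\<Sum>k\<le>j+1. B k j * (K * (2 * \<zeta> k * real k powr p) * norm x))"
        unfolding BT_def
      proof (rule sum_norm_le)
        fix k
        show "norm (of_real (B k j) * (W \<phi> x k - \<phi> k)) \<le> B k j * (K * (2 * \<zeta> k * real k powr p) * norm x)"
          using W_diff_bound[OF \<phi> that, of k] B_nonneg[of k j] unfolding norm_mult by (intro mult_mono) auto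
      qed
    qed
    also have "\<dots> = R j * norm x"
      by (simp only: R_def sum_distrib_right distrib_right mult.assoc)
    finally show ?thesis .
  qed
  have "norm ((W \<phi> z j - z * YT \<phi> j) - (W \<phi> 0 j - 0 * YT \<phi> j)) \<le> (R j * norm z) * norm (z - 0)"
  proof (rule field_differentiable_bound[OF convex_ccone_cball[of "norm z"], where f' = "\<lambda>z. YT (W \<phi> z) j - YT \<phi> j"])
    fix x assume x: "x \<in> ccone c \<inter> cball 0 (norm z)"
    have W': "((\<lambda>z. W \<phi> z j) has_field_derivative YT (W \<phi> x) j) (at x within ccone c \<inter> cball 0 (norm z))"
      using x by (intro DERIV_subset[OF W_deriv[OF b]]) auto
    show "((\<lambda>z. W \<phi> z j - z * YT \<phi> j) has_field_derivative YT (W \<phi> x) j - YT \<phi> j) (at x within ccone c \<inter> cball 0 (norm z))"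
      by (rule derivative_eq_intros W' refl | simp)+
    have "norm (YT (W \<phi> x) j - YT \<phi> j) \<le> R j * norm x"
      using x z by (intro d) auto
    also have "\<dots> \<le> R j * norm z" using x R0 by (intro mult_left_mono) auto
    finally show "norm (YT (W \<phi> x) j - YT \<phi> j) \<le> R j * norm z" .
  qed (use z in auto)
  then show ?thesis by (simp add: W_0 power2_eq_square algebra_simps)
qed

section \<open>Continuity at zero, semigroup law and holomorphy of the matrices\<close>

lemma TM_strongly_continuous_0:
  assumes f: "f \<in> Xsp p"
  shows "((\<lambda>z. wnorm p (\<lambda>i. matop (TM z) f i - f i)) \<longlongrightarrow> 0) (at 0 within ccone c)"
proof -
  \<comment> \<open>The two estimates have separate tasks: the first, uniform in \<open>z\<close>,
    dominates; the second tends to 0 in each column.\<close>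
  define m where "m z j = min ((K + 1) * real j powr p) (K * (2 * \<zeta> j * real j powr p) * norm z)" for z :: complex and j
  have near: "\<forall>\<^sub>F z in at 0 within ccone c. z \<in> ccone c \<and> norm z \<le> 1"
    unfolding eventually_at by (rule exI[of _ 1]) auto
  have "((\<lambda>z. wnorm p (matop (\<lambda>i j. TM z i j - idm i j) f)) \<longlongrightarrow> 0) (at 0 within ccone c)"
  proof (rule matop_tendsto_0)
    show "\<forall>\<^sub>F z in at 0 within ccone c. colbd p (\<lambda>i j. TM z i j - idm i j) (m z)"
      using near
    proof eventually_elim
      case (elim z)
      show ?case
      proof (rule colbdI_dual)
        fix N j and \<phi> :: "nat \<Rightarrow> complex" assume \<phi>: "\<And>i. norm (\<phi> i) \<le> real i powr p" "\<And>i. i > N \<Longrightarrow> \<phi> i = 0"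
        have b: "norm (\<phi> i) \<le> 1 * real i powr p" for i using \<phi>(1) by simp
        have "\<phi> 0 = 0" using \<phi>(1)[of 0] by simp
        then have "(\<Sum>i\<le>N. \<phi> i * (TM z i j - idm i j)) = W \<phi> z j - \<phi> j"
          using TM_pairing[OF b _ _ \<phi>(2), where j = j and N = N and z = z] idm_pairing[OF _ \<phi>(2), where j = j and N = N] elim
          by (simp add: right_diff_distrib sum_subtractf)
        moreover have "norm (W \<phi> z j - \<phi> j) \<le> (K + 1) * real j powr p"
          using norm_triangle_ineq4[of "W \<phi> z j" "\<phi> j"] W_bound_unit[OF \<phi>(1), of z j] elim \<phi>(1)[of j]
          by (simp add: distrib_right)
        ultimately show "norm (\<Sum>i\<le>N. \<phi> i * (TM z i j - idm i j)) \<le> m z j"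
          using W_diff_bound[OF \<phi>(1), of z j] elim by (simp add: m_def)
      qed (simp add: TM_def idm_def)
    qed
    show "((\<lambda>z. m z j) \<longlongrightarrow> 0) (at 0 within ccone c)" for j
    proof -
      have "((\<lambda>z. K * (2 * \<zeta> j * real j powr p) * norm z) \<longlongrightarrow> K * (2 * \<zeta> j * real j powr p) * norm (0::complex)) (at 0 within ccone c)"
        by (intro tendsto_intros)
      then have "((\<lambda>z. m z j) \<longlongrightarrow> min ((K + 1) * real j powr p) (K * (2 * \<zeta> j * real j powr p) * norm (0::complex))) (at 0 within ccone c)"
        unfolding m_def by (intro tendsto_intros)
      moreover have "min ((K + 1) * real j powr p) 0 = 0"
        using K_pos by (intro min_absorb2) simp
      ultimately show ?thesis by simp
    qed
    show "\<forall>\<^sub>F z in at 0 within ccone c. \<forall>j. m z j \<le> (K + 1) * real j powr p"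
      by (simp add: m_def)
    show "summable (\<lambda>j. (K + 1) * real j powr p * norm (f j))"
      by (rule Xsp_summable[OF f])
  qed
  moreover have "\<forall>\<^sub>F z in at 0 within ccone c. wnorm p (matop (\<lambda>i j. TM z i j - idm i j) f) = wnorm p (\<lambda>i. matop (TM z) f i - f i)"
    using near
  proof eventually_elim
    case (elim z)
    have "matop (\<lambda>i j. 1 * TM z i j + (-1) * idm i j) f i = 1 * matop (TM z) f i + (-1) * matop idm f i" for i
      using matop_summable[OF TM_colbd Xsp_summable[OF f]] elim by (intro matop_lincomb idm_summable) auto
    then show ?case using f by (simp add: matop_idm Xsp_def wnorm_def)
  qed
  ultimately show ?thesis by (rule Lim_transform_eventually)
qed

text \<open>Duality for infinitely supported \<open>\<psi>\<close>, as the semigroup law needs it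
  with a row of \<open>TM s\<close> in place of \<open>\<psi>\<close>. Truncations of
  \<open>\<psi>\<close> pair with finitely many rows, and \<open>W_truncation\<close> with the bound
  on \<open>W\<close> allows the limit.\<close>

lemma TM_pairing_suminf:
  assumes f: "f \<in> Xsp p" and \<psi>: "\<And>k. norm (\<psi> k) \<le> C * real k powr p" "0 \<le> C" and z: "z \<in> ccone c"
  shows "(\<Sum>k. \<psi> k * matop (TM z) f k) = (\<Sum>j. W \<psi> z j * f j)"
proof -
  note ms = matop_summable[OF TM_colbd[OF z] Xsp_summable[OF f]]
  have in_X: "matop (TM z) f \<in> Xsp p"
    by (rule matop_bound(1)[OF TM_colbd[OF z] Xsp_summable[OF f]])
  have "summable (\<lambda>k. norm (\<psi> k * matop (TM z) f k))"
    by (rule summable_comparison_test'[OF Xsp_summable[OF in_X, of C], of 0])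
      (auto simp: norm_mult intro!: mult_right_mono \<psi>)
  then have "(\<lambda>k. \<psi> k * matop (TM z) f k) sums (\<Sum>k. \<psi> k * matop (TM z) f k)"
    by (rule summable_sums[OF summable_norm_cancel])
  then have 1: "(\<lambda>N. \<Sum>k\<le>N. \<psi> k * matop (TM z) f k) \<longlonglongrightarrow> (\<Sum>k. \<psi> k * matop (TM z) f k)"
    by (simp add: sums_def_le)
  have "(\<Sum>k\<le>N. \<psi> k * matop (TM z) f k) = (\<Sum>j. W (\<lambda>k. if k \<le> N then \<psi> k else 0) z j * f j)" for N
  proof -
    have "(\<Sum>k\<le>N. \<psi> k * matop (TM z) f k) = (\<Sum>k\<le>N. (\<Sum>j. \<psi> k * (TM z k j * f j)))"
      unfolding matop_def by (intro sum.cong refl suminf_mult[symmetric] summable_norm_cancel[OF ms])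
    also have "\<dots> = (\<Sum>j. (\<Sum>k\<le>N. \<psi> k * (TM z k j * f j)))"
      by (intro suminf_sum[symmetric] summable_mult summable_norm_cancel[OF ms])
    also have "\<dots> = (\<Sum>j. (\<Sum>k\<le>N. \<psi> k * TM z k j) * f j)"
      by (simp add: sum_distrib_right mult.assoc)
    finally show ?thesis by (simp add: TM_truncated_pairing[OF \<psi> z])
  qed
  moreover have "(\<lambda>N. \<Sum>j. W (\<lambda>k. if k \<le> N then \<psi> k else 0) z j * f j) \<longlonglongrightarrow> (\<Sum>j. W \<psi> z j * f j)"
  proof (rule tendsto_suminf_dominated)
    show "(\<lambda>N. W (\<lambda>k. if k \<le> N then \<psi> k else 0) z j * f j) \<longlonglongrightarrow> W \<psi> z j * f j" for j
      by (intro tendsto_mult_right W_truncation[OF \<psi> z])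
    show "summable (\<lambda>j. (C * M z * real j powr p) * norm (f j))"
      by (rule Xsp_summable[OF f])
    have "norm (W (\<lambda>k. if k \<le> N then \<psi> k else 0) z j) \<le> C * M z * real j powr p" for N j
      using \<psi> by (intro W_bound z) auto
    then show "\<forall>\<^sub>F N in sequentially. \<forall>j. norm (W (\<lambda>k. if k \<le> N then \<psi> k else 0) z j * f j) \<le> (C * M z * real j powr p) * norm (f j)"
      by (simp add: norm_mult mult_right_mono)
  qed
  ultimately show ?thesis using LIMSEQ_unique[OF 1] by simp
qed

lemma TM_semigroup:
  assumes f: "f \<in> Xsp p" and s: "s \<in> ccone c" and z: "z \<in> ccone c"
  shows "matop (TM (s + z)) f = matop (TM s) (matop (TM z) f)"
proof
  fix i
  show "matop (TM (s + z)) f i = matop (TM s) (matop (TM z) f) i"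
  proof (cases "i = 0")
    case False
    have b: "norm (W (unit i) s k) \<le> (1 / real i powr p * M s) * real k powr p" for k
      using W_bound[OF unit_bound[OF False] _ s, of k] by simp
    have "matop (TM s) (matop (TM z) f) i = (\<Sum>k. W (unit i) s k * matop (TM z) f k)"
      using False by (simp add: matop_def TM_def)
    also have "\<dots> = (\<Sum>j. W (W (unit i) s) z j * f j)"
      using M_pos[of s] by (intro TM_pairing_suminf[OF f b _ z]) simp
    also have "\<dots> = (\<Sum>j. W (unit i) (s + z) j * f j)"
      using W_semigroup[OF unit_bound[OF False] _ s z] by simp
    finally show ?thesis using False by (simp add: matop_def TM_def)
  qed (simp add: matop_def TM_def)
qed

text \<open>Each pairing of a column with a test sequence is a scalar holomorphic function with a
  common bound on a disc. Cauchy's inequality thus bounds the derivative matrix by a multiple of the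
  weight, although the operator \<open>YT\<close> in it is unbounded.\<close>

lemma TM_holomorphic:
  assumes f: "f \<in> Xsp p" and z0: "z0 \<in> interior (ccone c)"
  shows "\<exists>h\<in>Xsp p. ((\<lambda>z. wnorm p (\<lambda>i. (matop (TM z) f i - matop (TM z0) f i) / (z - z0) - h i)) \<longlongrightarrow> 0) (at z0)"
proof -
  obtain r' where r': "0 < r'" "ball z0 r' \<subseteq> ccone c"
    using z0 by (meson mem_interior)
  define r where "r = r' / 3"
  have r: "0 < r" "ball z0 (3 * r) \<subseteq> ccone c" using r' by (auto simp: r_def)
  \<comment> \<open>\<open>M\<close> increases with \<open>Re z\<close>, so its value at the right
    end of the disc bounds it on the whole disc.\<close>
  define L where "L = M (of_real (Re z0 + 3 * r))"
  \<comment> \<open>The derivative at \<open>z0\<close>, read off row by row from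
    \<open>W_deriv\<close>; formally the matrix product of \<open>TM z0\<close> and
    \<open>YM\<close>.\<close>
  define DM where "DM i j = YT (TM z0 i) j" for i j
  have L: "0 < L" by (simp add: L_def M_pos)
  have z0c: "z0 \<in> ccone c" using r by auto
  have hol: "(\<lambda>z. W \<phi> z j) holomorphic_on ball z0 (3 * r)" "deriv (\<lambda>z. W \<phi> z j) z0 = YT (W \<phi> z0) j"
    if \<phi>: "\<And>k. norm (\<phi> k) \<le> 1 * real k powr p" for \<phi> j
  proof -
    have d: "((\<lambda>z. W \<phi> z j) has_field_derivative YT (W \<phi> z) j) (at z)" if "z \<in> ball z0 (3 * r)" for z
    proof -
      have "((\<lambda>z. W \<phi> z j) has_field_derivative YT (W \<phi> z) j) (at z within ball z0 (3 * r))"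
        using that r(2) by (intro DERIV_subset[OF W_deriv[OF \<phi>]]) auto
      then show ?thesis using that by (simp add: at_within_open[OF _ open_ball])
    qed
    then show "(\<lambda>z. W \<phi> z j) holomorphic_on ball z0 (3 * r)"
      unfolding holomorphic_on_open[OF open_ball] by blast
    show "deriv (\<lambda>z. W \<phi> z j) z0 = YT (W \<phi> z0) j"
      using r(1) by (intro DERIV_imp_deriv d) auto
  qed
  have Wb: "norm (W \<phi> z j) \<le> L * real j powr p"
    if \<phi>: "\<And>k. norm (\<phi> k) \<le> 1 * real k powr p" and z: "z \<in> ball z0 (3 * r)" for \<phi> j z
  proof -
    have "Re z - Re z0 \<le> norm (z - z0)" using complex_Re_le_cmod[of "z - z0"] by simp
    then have "M z \<le> L"
      using z unfolding L_def by (intro M_mono) (simp add: dist_norm norm_minus_commute)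
    then show ?thesis
      using W_bound[OF \<phi> _, of z j] z r(2) mult_right_mono[of "M z" L "real j powr p"] by auto
  qed
  have DM_pair: "(\<Sum>i\<le>N. \<phi> i * DM i j) = YT (W \<phi> z0) j"
    if \<phi>: "\<And>k. norm (\<phi> k) \<le> 1 * real k powr p" "\<And>k. k > N \<Longrightarrow> \<phi> k = 0" for \<phi> N j
  proof -
    have "YT (\<lambda>k. \<Sum>i\<le>N. \<phi> i * TM z0 i k) j = (\<Sum>i\<le>N. \<phi> i * DM i j)"
      unfolding YT_def BT_def DM_def distrib_left sum.distrib sum_distrib_left
      by (subst sum.swap) (simp add: mult_ac sum_negf)
    then show ?thesis using TM_pairing[OF \<phi>(1) _ z0c \<phi>(2)] by simp
  qed
  have DM0: "DM 0 j = 0" for j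
    by (simp add: DM_def YT_def BT_def TM_def)
  have DM_colbd: "colbd p DM (\<lambda>j. L / r * real j powr p)"
  proof (rule colbdI_dual[of DM, OF DM0])
    fix N j and \<phi> :: "nat \<Rightarrow> complex" assume \<phi>: "\<And>i. norm (\<phi> i) \<le> real i powr p" "\<And>i. i > N \<Longrightarrow> \<phi> i = 0"
    have b: "norm (\<phi> i) \<le> 1 * real i powr p" for i using \<phi>(1) by simp
    show "norm (\<Sum>i\<le>N. \<phi> i * DM i j) \<le> L / r * real j powr p"
      using holomorphic_difference_quotient_bound(1)[OF hol(1)[OF b] r(1) Wb[OF b], of z0 j] hol(2)[OF b, of j]
        DM_pair[OF b \<phi>(2), where j = j and N = N] r(1) by simp
  qed
  have hX: "matop DM f \<in> Xsp p"
    by (rule matop_bound(1)[OF DM_colbd Xsp_summable[OF f]])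
  have near: "\<forall>\<^sub>F z in at z0. z \<in> ccone c \<and> z \<noteq> z0 \<and> norm (z - z0) < r"
    unfolding eventually_at by (rule exI[of _ r]) (use r in \<open>auto simp: dist_norm norm_minus_commute\<close>)
  define Q where "Q z i j = (TM z i j - TM z0 i j) / (z - z0) - DM i j" for z i j
  define m where "m z j = 2 * L * real j powr p / r\<^sup>2 * norm (z - z0)" for z and j :: nat
  have "((\<lambda>z. wnorm p (matop (Q z) f)) \<longlongrightarrow> 0) (at z0)"
  proof (rule matop_tendsto_0)
    show "\<forall>\<^sub>F z in at z0. colbd p (Q z) (m z)"
      using near
    proof eventually_elim
      case (elim z)
      show ?case
      proof (rule colbdI_dual)
        show "Q z 0 j = 0" for j by (simp add: Q_def TM_def DM0)
        fix N j and \<phi> :: "nat \<Rightarrow> complex" assume \<phi>: "\<And>i. norm (\<phi> i) \<le> real i powr p" "\<And>i. i > N \<Longrightarrow> \<phi> i = 0"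
        have b: "norm (\<phi> i) \<le> 1 * real i powr p" for i using \<phi>(1) by simp
        have "(\<Sum>i\<le>N. \<phi> i * Q z i j) = (W \<phi> z j - W \<phi> z0 j) / (z - z0) - YT (W \<phi> z0) j"
          using TM_pairing[OF b _ conjunct1[OF elim] \<phi>(2), where j = j and N = N] TM_pairing[OF b _ z0c \<phi>(2), where j = j and N = N]
            DM_pair[OF b \<phi>(2), where j = j and N = N]
          by (simp add: Q_def right_diff_distrib sum_subtractf diff_divide_distrib flip: sum_divide_distrib)
        then show "norm (\<Sum>i\<le>N. \<phi> i * Q z i j) \<le> m z j"
          using holomorphic_difference_quotient_bound(2)[OF hol(1)[OF b] r(1) Wb[OF b], of z j] hol(2)[OF b, of j] elim
          by (simp add: m_def mult.assoc)
      qed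
    qed
    have "((\<lambda>z. m z j) \<longlongrightarrow> 2 * L * real j powr p / r\<^sup>2 * norm (z0 - z0)) (at z0)" for j
      unfolding m_def by (intro tendsto_intros)
    then show "((\<lambda>z. m z j) \<longlongrightarrow> 0) (at z0)" for j by simp
    show "\<forall>\<^sub>F z in at z0. \<forall>j. m z j \<le> (2 * L / r\<^sup>2 * r) * real j powr p"
      using near
    proof eventually_elim
      case (elim z)
      show ?case
      proof
        fix j
        have "2 * L * real j powr p / r\<^sup>2 * norm (z - z0) \<le> 2 * L * real j powr p / r\<^sup>2 * r"
          using elim L by (intro mult_left_mono) auto
        then show "m z j \<le> (2 * L / r\<^sup>2 * r) * real j powr p"
          by (simp add: m_def mult_ac)
      qed
    qed
    show "summable (\<lambda>j. (2 * L / r\<^sup>2 * r) * real j powr p * norm (f j))"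
      by (rule Xsp_summable[OF f])
  qed
  moreover have "\<forall>\<^sub>F z in at z0. wnorm p (matop (Q z) f) = wnorm p (\<lambda>i. (matop (TM z) f i - matop (TM z0) f i) / (z - z0) - matop DM f i)"
    using near
  proof eventually_elim
    case (elim z)
    have "matop (Q z) f i = (matop (TM z) f i - matop (TM z0) f i) / (z - z0) - matop DM f i" for i
    proof -
      have "(\<lambda>j. (TM z i j * f j - TM z0 i j * f j) / (z - z0) - DM i j * f j) sums
          ((matop (TM z) f i - matop (TM z0) f i) / (z - z0) - matop DM f i)"
        unfolding matop_def
        using elim by (intro sums_diff sums_divide summable_sums
            summable_norm_cancel[OF matop_summable[OF TM_colbd Xsp_summable[OF f]]]
            summable_norm_cancel[OF matop_summable[OF DM_colbd Xsp_summable[OF f]]] z0c) auto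
      then show ?thesis
        unfolding matop_def[of "Q z"] Q_def by (simp add: sums_iff left_diff_distrib)
    qed
    then show ?case by (simp add: wnorm_def)
  qed
  ultimately have "((\<lambda>z. wnorm p (\<lambda>i. (matop (TM z) f i - matop (TM z0) f i) / (z - z0) - matop DM f i)) \<longlongrightarrow> 0) (at z0)"
    by (rule Lim_transform_eventually)
  then show ?thesis using hX by blast
qed

subsection \<open>The real semigroup and its generator\<close>

lemma of_real_mem_ccone: "0 \<le> t \<Longrightarrow> complex_of_real t \<in> ccone c"
  using of_real_in_ccone \<kappa>c by simp

text \<open>At real times the entries of \<open>TM\<close> are nonnegative reals, so taking the real
  part loses nothing.\<close>

definition SM :: "real \<Rightarrow> nat \<Rightarrow> nat \<Rightarrow> real" where
  "SM t i j = Re (TM (of_real t) i j)"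

lemma TM_nonneg_Reals:
  assumes "0 \<le> t"
  shows "TM (of_real t) i j \<in> \<real>\<^sub>\<ge>\<^sub>0"
proof (cases "i = 0")
  case False
  have "exp (of_real \<omega> * of_real t) = complex_of_real (exp (\<omega> * t))"
    by (simp flip: exp_of_real)
  moreover have "V (unit i) (of_real t) j \<in> \<real>\<^sub>\<ge>\<^sub>0"
    by (rule V_nonneg_Reals[OF _ unit_bound[OF False] _ assms]) (auto simp: unit_def)
  ultimately show ?thesis
    using False by (simp add: TM_def W_def complex_nonneg_Reals_iff)
qed (simp add: TM_def)

lemma SM_nonneg: "0 \<le> t \<Longrightarrow> 0 \<le> SM t i j"
  and TM_of_real: "0 \<le> t \<Longrightarrow> TM (of_real t) i j = of_real (SM t i j)"
  using TM_nonneg_Reals[of t i j] by (auto simp: SM_def complex_nonneg_Reals_iff complex_eq_iff)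

lemma SM_colbd: "0 \<le> t \<Longrightarrow> colbd p (SM t) (\<lambda>j. M (of_real t) * real j powr p)"
  using colbd_Re[OF TM_colbd[OF of_real_mem_ccone]] by (simp add: SM_def[abs_def])

lemma matop_TM_cplx:
  assumes h: "h \<in> Xsp p" and t: "0 \<le> t"
  shows "matop (TM (of_real t)) h = cplx (matop (SM t)) h"
proof
  fix i
  have s: "summable (\<lambda>j. TM (of_real t) i j * h j)"
    by (rule summable_norm_cancel[OF matop_summable[OF TM_colbd[OF of_real_mem_ccone[OF t]] Xsp_summable[OF h]]])
  show "matop (TM (of_real t)) h i = cplx (matop (SM t)) h i"
    using bounded_linear.suminf[OF bounded_linear_Re s] bounded_linear.suminf[OF bounded_linear_Im s]
    by (simp add: complex_eq_iff cplx_def matop_def TM_of_real[OF t])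
qed

lemma matop_TM_of_real:
  assumes f: "f \<in> Xsp p" and t: "0 \<le> t"
  shows "matop (TM (of_real t)) (\<lambda>j. of_real (f j)) = (\<lambda>i. of_real (matop (SM t) f i))"
  using matop_TM_cplx[of "\<lambda>j. of_real (f j)" t] f t
  by (simp add: Xsp_of_real cplx_def fun_eq_iff) (simp add: matop_def)

lemma SM_in_Xsp: "0 \<le> t \<Longrightarrow> f \<in> Xsp p \<Longrightarrow> matop (SM t) f \<in> Xsp p"
  by (rule matop_bound(1)[OF SM_colbd Xsp_summable])

lemma SM_linear:
  assumes t: "0 \<le> t" and f: "f \<in> Xsp p" and h: "h \<in> Xsp p"
  shows "matop (SM t) (\<lambda>i. a * f i + b * h i) = (\<lambda>i. a * matop (SM t) f i + b * matop (SM t) h i)"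
  using matop_add[OF SM_colbd[OF t] Xsp_summable Xsp_summable, OF Xsp_cmult[OF f] Xsp_cmult[OF h], of a b]
    matop_cmult[OF SM_colbd[OF t] Xsp_summable[OF f], of a] matop_cmult[OF SM_colbd[OF t] Xsp_summable[OF h], of b]
  by simp

lemma SM_semigroup:
  assumes f: "f \<in> Xsp p" and s: "0 \<le> s" and t: "0 \<le> t"
  shows "matop (SM (s + t)) f = matop (SM s) (matop (SM t) f)"
proof -
  have "(\<lambda>i. complex_of_real (matop (SM (s + t)) f i)) = matop (TM (of_real s + of_real t)) (\<lambda>j. of_real (f j))"
    using matop_TM_of_real[OF f, of "s + t"] s t by simp
  also have "\<dots> = matop (TM (of_real s)) (matop (TM (of_real t)) (\<lambda>j. of_real (f j)))"
    using f s t by (intro TM_semigroup of_real_mem_ccone) (auto simp: Xsp_of_real)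
  also have "\<dots> = (\<lambda>i. of_real (matop (SM s) (matop (SM t) f) i))"
    using matop_TM_of_real[OF f t] matop_TM_of_real[OF SM_in_Xsp[OF t f] s] by simp
  finally show ?thesis by (simp add: fun_eq_iff)
qed

lemma SM_strongly_continuous_0:
  assumes f: "f \<in> Xsp p"
  shows "((\<lambda>t. wnorm p (\<lambda>i. matop (SM t) f i - f i)) \<longlongrightarrow> 0) (at_right 0)"
proof -
  have pos: "\<forall>\<^sub>F t in at_right (0::real). 0 < t"
    by (simp add: eventually_at_right_less)
  have "filterlim complex_of_real (at 0 within ccone c) (at_right 0)"
    unfolding filterlim_at
  proof
    show "\<forall>\<^sub>F t in at_right 0. complex_of_real t \<in> ccone c \<and> complex_of_real t \<noteq> 0"
      using pos by eventually_elim (simp add: of_real_mem_ccone)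
    show "(complex_of_real \<longlongrightarrow> 0) (at_right 0)"
      using tendsto_of_real[OF tendsto_ident_at[of 0 "{0<..}"], where 'a = complex] by simp
  qed
  from filterlim_compose[OF TM_strongly_continuous_0[of "\<lambda>j. of_real (f j)"] this] f
  have "((\<lambda>t. wnorm p (\<lambda>i. matop (TM (of_real t)) (\<lambda>j. of_real (f j)) i - of_real (f i))) \<longlongrightarrow> 0) (at_right 0)"
    by (simp add: Xsp_of_real)
  moreover have "\<forall>\<^sub>F t in at_right 0. wnorm p (\<lambda>i. matop (TM (of_real t)) (\<lambda>j. of_real (f j)) i - of_real (f i))
      = wnorm p (\<lambda>i. matop (SM t) f i - f i)"
    using pos
  proof eventually_elim
    case (elim t)
    then show ?case
      by (simp add: matop_TM_of_real[OF f] wnorm_def flip: of_real_diff)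
  qed
  ultimately show ?thesis by (rule Lim_transform_eventually)
qed

text \<open>The columns of the difference quotient are dominated by a multiple of
  \<open>\<zeta> j * real j powr p\<close>, for which membership in the domain gives exactly the
  summability required; convergence in each column comes from the quadratic estimate with
  \<open>R\<close>.\<close>

lemma SM_generator:
  assumes f: "f \<in> Xsp p" and s: "summable (\<lambda>j. (\<zeta> j * real j powr p) * norm (f j))"
  shows "((\<lambda>t. wnorm p (\<lambda>i. (matop (SM t) f i - f i) / t - matop YM f i)) \<longlongrightarrow> 0) (at_right 0)"
proof -
  have near: "\<forall>\<^sub>F t in at_right (0::real). 0 < t \<and> t \<le> 1"
    unfolding eventually_at by (rule exI[of _ 1]) (auto simp: dist_real_def)
  \<comment> \<open>\<open>2 * K\<close> bounds the difference quotient and \<open>2\<close> bounds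
    \<open>YT\<close>.\<close>
  define D where "D j = (2 * K + 2) * (\<zeta> j * real j powr p)" for j
  define m where "m t j = min (D j) (R j * t)" for t j
  define Q where "Q t i j = (TM (of_real t) i j - idm i j) / of_real t - of_real (YM i j)" for t i j
  have D0: "0 \<le> D j" for j using K_pos \<zeta>_pos[of j] by (simp add: D_def)
  have sD: "summable (\<lambda>j. D j * norm (f j))"
    using summable_mult[OF s, of "2 * K + 2"] by (simp add: D_def mult.assoc)
  have sY: "summable (\<lambda>j. norm (YM i j * f j))" for i
    using summable_mult[OF s, of 2] by (intro matop_summable[OF YM_colbd]) (simp add: mult.assoc)
  have "((\<lambda>t. wnorm p (matop (\<lambda>i j. Re (Q t i j)) f)) \<longlongrightarrow> 0) (at_right 0)"
  proof (rule matop_tendsto_0)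
    show "\<forall>\<^sub>F t in at_right 0. colbd p (\<lambda>i j. Re (Q t i j)) (m t)"
      using near
    proof eventually_elim
      case (elim t)
      have tc: "of_real t \<in> ccone c" "norm (complex_of_real t) \<le> 1" using elim of_real_mem_ccone by auto
      show ?case
      proof (intro colbd_Re colbdI_dual)
        show "Q t 0 j = 0" for j by (simp add: Q_def TM_def idm_def YM_def)
        fix N j and \<phi> :: "nat \<Rightarrow> complex" assume \<phi>: "\<And>i. norm (\<phi> i) \<le> real i powr p" "\<And>i. i > N \<Longrightarrow> \<phi> i = 0"
        have b: "norm (\<phi> i) \<le> 1 * real i powr p" for i using \<phi>(1) by simp
        have \<phi>0: "\<phi> 0 = 0" using \<phi>(1)[of 0] by simp
        have eq: "(\<Sum>i\<le>N. \<phi> i * Q t i j) = (W \<phi> (of_real t) j - \<phi> j) / of_real t - YT \<phi> j"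
          using TM_pairing[OF b _ tc(1) \<phi>(2), where j = j and N = N] idm_pairing[where \<phi> = \<phi> and j = j and N = N, OF \<phi>0 \<phi>(2)]
            YM_pairing[where \<phi> = \<phi> and j = j and N = N, OF \<phi>0 \<phi>(2)]
          by (simp add: Q_def right_diff_distrib sum_subtractf diff_divide_distrib flip: sum_divide_distrib)
        have "norm ((W \<phi> (of_real t) j - \<phi> j) / of_real t) \<le> K * (2 * \<zeta> j * real j powr p)"
          using W_diff_bound[OF \<phi>(1) tc, of j] elim by (simp add: norm_divide divide_le_eq)
        then have 1: "norm ((W \<phi> (of_real t) j - \<phi> j) / of_real t - YT \<phi> j) \<le> D j"
          using YT_bound[OF b, of j] norm_triangle_ineq4[of "(W \<phi> (of_real t) j - \<phi> j) / of_real t" "YT \<phi> j"]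
          by (simp add: D_def algebra_simps)
        have "(W \<phi> (of_real t) j - \<phi> j) / of_real t - YT \<phi> j = (W \<phi> (of_real t) j - \<phi> j - of_real t * YT \<phi> j) / of_real t"
          using elim by (simp add: field_simps)
        then have 2: "norm ((W \<phi> (of_real t) j - \<phi> j) / of_real t - YT \<phi> j) \<le> R j * t"
          using W_diff2_bound[OF \<phi>(1) tc, of j] elim by (simp add: norm_divide divide_le_eq power2_eq_square mult.assoc)
        show "norm (\<Sum>i\<le>N. \<phi> i * Q t i j) \<le> m t j"
          unfolding eq m_def using 1 2 by simp
      qed
    qed
    show "((\<lambda>t. m t j) \<longlongrightarrow> 0) (at_right 0)" for j
    proof -
      have "((\<lambda>t. m t j) \<longlongrightarrow> min (D j) (R j * 0)) (at_right 0)"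
        unfolding m_def by (intro tendsto_intros)
      then show ?thesis using D0[of j] by (simp add: min_absorb2)
    qed
    show "\<forall>\<^sub>F t in at_right 0. \<forall>j. m t j \<le> D j" by (simp add: m_def)
  qed (rule sD)
  moreover have "\<forall>\<^sub>F t in at_right 0. wnorm p (matop (\<lambda>i j. Re (Q t i j)) f) = wnorm p (\<lambda>i. (matop (SM t) f i - f i) / t - matop YM f i)"
    using near
  proof eventually_elim
    case (elim t)
    have "matop (\<lambda>i j. Re (Q t i j)) f i = (matop (SM t) f i - f i) / t - matop YM f i" for i
    proof -
      have "Re (idm i j) = idm i j" for j by (simp add: idm_def)
      then have "Re (Q t i j) * f j = (SM t i j * f j - idm i j * f j) / t - YM i j * f j" for j
        by (simp add: Q_def SM_def left_diff_distrib)
      moreover have "(\<lambda>j. (SM t i j * f j - idm i j * f j) / t - YM i j * f j) sums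
          ((matop (SM t) f i - f i) / t - matop YM f i)"
        unfolding matop_def using elim f
        by (intro sums_diff sums_divide summable_sums summable_norm_cancel[OF sY] idm_sums
            summable_norm_cancel[OF matop_summable[OF SM_colbd Xsp_summable[OF f]]])
          (auto simp: Xsp_def)
      ultimately show ?thesis
        unfolding matop_def[of "\<lambda>i j. Re (Q t i j)"] by (simp add: sums_iff)
    qed
    then show ?case by (simp add: wnorm_def)
  qed
  ultimately show ?thesis by (rule Lim_transform_eventually)
qed

section \<open>Exactness of the domain: resolvent and growth arguments\<close>

lemma domain_summable:
  assumes f: "f \<in> Xsp p" and \<theta>f: "(\<lambda>i. \<theta> i * f i) \<in> Xsp p"
  shows "summable (\<lambda>j. (\<zeta> j * real j powr p) * norm (f j))"
proof -
  have "summable (\<lambda>j. real j powr p * norm (\<theta> j * f j) + (\<omega> * real j powr p) * norm (f j))"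
    using \<theta>f by (intro summable_add Xsp_summable f) (simp add: Xsp_def)
  then show ?thesis
    using \<theta>_nonneg by (simp add: \<zeta>_def abs_mult algebra_simps)
qed

lemma YM_in_Xsp:
  assumes "f \<in> Xsp p" "(\<lambda>i. \<theta> i * f i) \<in> Xsp p"
  shows "matop YM f \<in> Xsp p"
  using summable_mult[OF domain_summable[OF assms], of 2]
  by (intro matop_bound(1)[OF YM_colbd]) (simp add: mult.assoc)

text \<open>With \<open>\<xi> = \<theta> + \<mu>\<close>, factor \<open>\<mu> - Y\<close> as
  \<open>(I - G) \<xi>\<close>, where \<open>G\<close> is \<open>B\<close> with column
  \<open>j\<close> divided by \<open>\<xi> j\<close>. Because \<open>\<omega> \<le> \<mu>\<close>,
  \<open>G\<close> contracts by \<open>\<kappa>\<close>; the Neumann series yields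
  \<open>x = h + G x\<close>, and \<open>u = x / \<xi>\<close> lies in the domain of the diagonal
  part.\<close>

lemma resolvent_surj:
  assumes h: "h \<in> Xsp p" and \<mu>: "\<omega> \<le> \<mu>"
  shows "\<exists>u\<in>Xsp p. (\<lambda>i. \<theta> i * u i) \<in> Xsp p \<and> (\<forall>i. \<mu> * u i - matop YM u i = h i)"
proof -
  define \<xi> where "\<xi> j = \<theta> j + \<mu>" for j
  have \<xi>: "0 < \<xi> j" "\<zeta> j \<le> \<xi> j" for j
    using \<zeta>_pos[of j] \<mu> by (auto simp: \<xi>_def \<zeta>_def)
  define G where "G i j = B i j / \<xi> j" for i j
  have "colbd p G (\<lambda>j. \<kappa> * real j powr p)"
    unfolding colbd_def
  proof (intro conjI allI)
    show "G 0 j = 0" for j by (simp add: G_def B_0)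
    fix j N
    have "(\<Sum>i\<le>N. real i powr p * norm (G i j)) = (\<Sum>i\<le>N. real i powr p * B i j) / \<xi> j"
      using \<xi>(1)[of j] B_nonneg by (simp add: G_def abs_mult sum_divide_distrib)
    also have "(\<Sum>i\<le>N. real i powr p * B i j) \<le> (\<Sum>i\<le>N+j+1. real i powr p * B i j)"
      using B_nonneg by (intro sum_mono2) auto
    also have "\<dots> = (\<Sum>i\<le>j+1. real i powr p * B i j)"
      using B_upper by (intro sum.mono_neutral_right) auto
    also have "\<dots> \<le> \<kappa> * \<zeta> j * real j powr p"
      using B_col[of j] by (simp add: \<zeta>_def)
    also have "\<dots> \<le> \<kappa> * \<xi> j * real j powr p"
      using \<kappa>c \<xi>(2)[of j] by (intro mult_right_mono mult_left_mono) auto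
    finally show "(\<Sum>i\<le>N. real i powr p * norm (G i j)) \<le> \<kappa> * real j powr p"
      using \<xi>(1)[of j] by (simp add: divide_right_mono field_simps)
  qed
  then obtain x where x: "x \<in> Xsp p" "\<And>i. x i = h i + matop G x i"
    using neumann_series[of p G \<kappa> h] \<kappa>c h by auto
  define u where "u j = x j / \<xi> j" for j
  have b: "norm (u j) \<le> norm (x j) / \<omega>" "norm (\<theta> j * u j) \<le> norm (x j)" for j
  proof -
    have "\<omega> \<le> \<xi> j" using \<theta>_nonneg[of j] \<mu> by (simp add: \<xi>_def)
    then show "norm (u j) \<le> norm (x j) / \<omega>"
      using \<omega>_pos \<xi>(1)[of j] by (simp add: u_def frac_le)
    have "\<theta> j * norm (x j) \<le> \<xi> j * norm (x j)"
      using \<omega>_pos \<mu> by (intro mult_right_mono) (auto simp: \<xi>_def)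
    then show "norm (\<theta> j * u j) \<le> norm (x j)"
      using \<xi>(1)[of j] \<theta>_nonneg[of j] by (simp add: u_def abs_mult field_simps)
  qed
  have x0: "x 0 = 0" using x by (simp add: Xsp_def)
  have uX: "u \<in> Xsp p"
  proof -
    have "summable (\<lambda>j. real j powr p * norm (u j))"
      by (rule summable_comparison_test'[OF Xsp_summable[OF x(1), of "1 / \<omega>"], of 0])
        (use b(1) mult_left_mono[of "norm (u _)" "norm (x _) / \<omega>" "real _ powr p"] in \<open>auto simp: field_simps\<close>)
    then show ?thesis by (simp add: Xsp_def u_def x0)
  qed
  have \<theta>uX: "(\<lambda>i. \<theta> i * u i) \<in> Xsp p"
  proof -
    have "summable (\<lambda>j. real j powr p * norm (\<theta> j * u j))"
      by (rule summable_comparison_test'[OF Xsp_summable[OF x(1), of 1], of 0])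
        (use b(2) in \<open>auto intro!: mult_left_mono\<close>)
    then show ?thesis by (simp add: Xsp_def u_def x0)
  qed
  have "\<mu> * u i - matop YM u i = h i" for i
  proof (cases "i = 0")
    case True
    then show ?thesis using h by (simp add: matop_def YM_def u_def x0 Xsp_def)
  next
    case False
    have "summable (\<lambda>j. norm (YM i j * u j))"
      using summable_mult[OF domain_summable[OF uX \<theta>uX], of 2]
      by (intro matop_summable[OF YM_colbd]) (simp add: mult.assoc)
    then have s: "(\<lambda>j. YM i j * u j) sums matop YM u i"
      unfolding matop_def by (rule summable_sums[OF summable_norm_cancel])
    have "(\<lambda>j. YM i j * u j - (if j = i then - \<theta> j * u j else 0)) sums (matop YM u i - (- \<theta> i * u i))"
      by (intro sums_diff s sums_single)
    moreover have "YM i j * u j - (if j = i then - \<theta> j * u j else 0) = G i j * x j" for j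
      using False \<xi>(1)[of j] by (auto simp: YM_def G_def u_def diff_divide_distrib algebra_simps)
    ultimately have "matop G x i = matop YM u i + \<theta> i * u i"
      by (simp add: matop_def sums_iff)
    moreover have "x i = \<xi> i * u i" using \<xi>(1)[of i] by (simp add: u_def)
    ultimately show ?thesis using x(2)[of i] by (simp add: \<xi>_def algebra_simps)
  qed
  then show ?thesis using uX \<theta>uX by blast
qed

text \<open>The generator limit only yields right derivatives. Holomorphy supplies two-sided ones,
  so functions with vanishing derivative can later be recognised as constant.\<close>

lemma SM_component_deriv:
  assumes x: "x \<in> Xsp p" and t: "0 < t"
  shows "\<exists>D. ((\<lambda>t. matop (SM t) x i) has_field_derivative D) (at t)"
proof -
  let ?h = "\<lambda>j. complex_of_real (x j)"
  have hX: "?h \<in> Xsp p" using x by (simp add: Xsp_of_real)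
  have tc: "complex_of_real t \<in> interior (ccone c)"
    using t \<kappa>c by (intro mem_interior_ccone) simp
  obtain g where g: "g \<in> Xsp p" and lim: "((\<lambda>z. wnorm p (\<lambda>i. (matop (TM z) ?h i - matop (TM (of_real t)) ?h i) / (z - of_real t) - g i)) \<longlongrightarrow> 0) (at (of_real t))"
    using TM_holomorphic[OF hX tc] by auto
  have "\<forall>\<^sub>F z in at (of_real t). z \<in> interior (ccone c)"
    using tc by (meson eventually_at_topological open_interior)
  then have "\<forall>\<^sub>F z in at (of_real t). (\<lambda>i. (matop (TM z) ?h i - matop (TM (of_real t)) ?h i) / (z - of_real t) - g i) \<in> Xsp p"
  proof eventually_elim
    case (elim z)
    have T: "matop (TM z) ?h \<in> Xsp p" "matop (TM (of_real t)) ?h \<in> Xsp p"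
      using elim tc interior_subset by (auto intro!: matop_bound(1)[OF TM_colbd Xsp_summable[OF hX]])
    have "(\<lambda>i. 1 / (z - of_real t) * (matop (TM z) ?h i + (-1) * matop (TM (of_real t)) ?h i) + (-1) * g i) \<in> Xsp p"
      by (intro Xsp_add Xsp_cmult T g)
    then show ?case by simp
  qed
  from wnorm_tendsto_component[OF lim this, of i]
  have "((\<lambda>z. (matop (TM z) ?h i - matop (TM (of_real t)) ?h i) / (z - of_real t) - g i) \<longlongrightarrow> 0) (at (of_real t))" .
  then have "((\<lambda>z. matop (TM z) ?h i) has_field_derivative g i) (at (of_real t))"
    unfolding has_field_derivative_iff by (rule LIM_zero_cancel)
  then have "((\<lambda>t. matop (TM (of_real t)) ?h i) has_vector_derivative g i) (at t)"
    by (rule has_vector_derivative_real_field)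
  then have "((\<lambda>t. Re (matop (TM (of_real t)) ?h i)) has_field_derivative Re (g i)) (at t)"
    by (rule has_field_derivative_Re)
  then have "((\<lambda>t. matop (SM t) x i) has_field_derivative Re (g i)) (at t)"
    by (rule has_field_derivative_transform_within_open[of _ _ _ "{0<..}"])
      (use t matop_TM_of_real[OF x] in auto)
  then show ?thesis by blast
qed

text \<open>An eigenvector for \<open>\<mu>\<close> would have components solving
  \<open>y' = \<mu> * y\<close> for \<open>t > 0\<close>, so \<open>exp (- \<mu> * t) * y t\<close>
  is constant. The growth bound \<open>exp (\<omega> * t)\<close> with
  \<open>\<omega> < \<mu>\<close> forces this constant to be 0, and continuity at 0 passes this on
  to \<open>x\<close>.\<close>

lemma generator_inj:
  assumes x: "x \<in> Xsp p" and \<mu>: "\<omega> < \<mu>"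
    and lim: "((\<lambda>t. wnorm p (\<lambda>i. (matop (SM t) x i - x i) / t - \<mu> * x i)) \<longlongrightarrow> 0) (at_right 0)"
  shows "x i = 0"
proof (cases "i = 0")
  case True
  then show ?thesis using x by (simp add: Xsp_def)
next
  case False
  define y where "y t = matop (SM t) x i" for t
  have pos: "\<forall>\<^sub>F h in at_right (0::real). 0 < h"
    by (simp add: eventually_at_right_less)
  define v where "v h = (\<lambda>k. (matop (SM h) x k - x k) / h - \<mu> * x k)" for h
  have vX: "v h \<in> Xsp p" if "0 < h" for h
  proof -
    have "(\<lambda>i. 1 / h * (matop (SM h) x i + (-1) * x i) + (-\<mu>) * x i) \<in> Xsp p"
      using that by (intro Xsp_add Xsp_cmult x SM_in_Xsp) auto
    then show ?thesis by (simp add: v_def)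
  qed
  have der: "(y has_field_derivative \<mu> * y t) (at t)" if t: "0 < t" for t
  proof -
    obtain D where D: "(y has_field_derivative D) (at t)"
      using SM_component_deriv[OF x t, of i] unfolding y_def by blast
    \<comment> \<open>The value of \<open>D\<close> is found from the right-hand limit alone:
      \<open>S t\<close> applied to the generator limit at time 0 gives the quotient at time
      \<open>t\<close>.\<close>
    then have 1: "((\<lambda>h. (y (t + h) - y t) / h) \<longlongrightarrow> D) (at_right 0)"
      unfolding DERIV_def using filterlim_at_split by blast
    have bd: "bounded_op p (matop (SM t))"
      using t by (intro matop_bounded_op[OF SM_colbd]) simp
    then obtain C where C: "\<And>f. f \<in> Xsp p \<Longrightarrow> wnorm p (matop (SM t) f) \<le> C * wnorm p f"
      unfolding bounded_op_def by blast
    have "((\<lambda>h. wnorm p (matop (SM t) (v h))) \<longlongrightarrow> 0) (at_right 0)"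
    proof (rule tendsto_sandwich[OF _ _ tendsto_const])
      show "\<forall>\<^sub>F h in at_right 0. 0 \<le> wnorm p (matop (SM t) (v h))"
        using pos by eventually_elim (use t in \<open>auto intro!: wnorm_nonneg SM_in_Xsp vX\<close>)
      show "\<forall>\<^sub>F h in at_right 0. wnorm p (matop (SM t) (v h)) \<le> C * wnorm p (v h)"
        using pos by eventually_elim (auto intro!: C vX)
      show "((\<lambda>h. C * wnorm p (v h)) \<longlongrightarrow> 0) (at_right 0)"
        using tendsto_mult_left[OF lim, of C] by (simp add: v_def)
    qed
    then have "((\<lambda>h. matop (SM t) (v h) i) \<longlongrightarrow> 0) (at_right 0)"
      by (rule wnorm_tendsto_component)
        (use pos in \<open>eventually_elim, use t in \<open>auto intro!: SM_in_Xsp vX\<close>\<close>)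
    moreover have "\<forall>\<^sub>F h in at_right 0. matop (SM t) (v h) i = (y (t + h) - y t) / h - \<mu> * y t"
      using pos
    proof eventually_elim
      case (elim h)
      have Sx: "matop (SM h) x \<in> Xsp p" using elim x by (intro SM_in_Xsp) auto
      have "v h = (\<lambda>i. 1 / h * matop (SM h) x i + (- 1 / h - \<mu>) * x i)"
        by (simp add: v_def diff_divide_distrib algebra_simps)
      then have "matop (SM t) (v h) i = 1 / h * matop (SM t) (matop (SM h) x) i + (- 1 / h - \<mu>) * matop (SM t) x i"
        using SM_linear[OF _ Sx x, of t "1 / h" "- 1 / h - \<mu>"] t by simp
      then show ?case
        using SM_semigroup[OF x, of t h] elim t by (simp add: y_def diff_divide_distrib algebra_simps)
    qed
    ultimately have "((\<lambda>h. (y (t + h) - y t) / h - \<mu> * y t) \<longlongrightarrow> 0) (at_right 0)"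
      by (rule Lim_transform_eventually)
    then have "((\<lambda>h. (y (t + h) - y t) / h) \<longlongrightarrow> \<mu> * y t) (at_right 0)"
      by (rule LIM_zero_cancel)
    then have "D = \<mu> * y t"
      using tendsto_unique[OF _ 1] by simp
    then show ?thesis using D by simp
  qed
  have const: "exp (- \<mu> * s) * y s = exp (- \<mu> * t) * y t" if "0 < s" "s < t" for s t
  proof (rule DERIV_isconst3[where a = 0 and b = "t + 1" and f = "\<lambda>t. exp (- \<mu> * t) * y t"])
    fix r assume "r \<in> {0<..<t + 1}"
    then have r: "0 < r" by simp
    show "((\<lambda>t. exp (- \<mu> * t) * y t) has_field_derivative 0) (at r)"
      by (rule derivative_eq_intros der[OF r] refl | simp add: algebra_simps)+
  qed (use that in auto)
  have y0: "y s = 0" if s: "0 < s" for s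
  proof -
    define A where "A = wnorm p x / ((1 - q) * real i powr p)"
    have bound: "norm (exp (- \<mu> * s) * y s) \<le> A * exp ((\<omega> - \<mu>) * t)" if t: "s < t" for t
    proof -
      have t0: "0 \<le> t" using s t by simp
      have "real i powr p * norm (y t) \<le> wnorm p (matop (SM t) x)"
        unfolding y_def by (rule entry_le_wnorm[OF SM_in_Xsp[OF t0 x]])
      also have "\<dots> \<le> (\<Sum>j. M (of_real t) * real j powr p * norm (x j))"
        by (rule matop_bound(2)[OF SM_colbd[OF t0] Xsp_summable[OF x]])
      also have "\<dots> = M (of_real t) * wnorm p x"
        using x by (simp add: wnorm_def Xsp_def mult.assoc suminf_mult)
      finally have "norm (y t) \<le> A * exp (\<omega> * t)"
        using False q by (simp add: A_def M_def field_simps)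
      then have "exp (- \<mu> * t) * norm (y t) \<le> exp (- \<mu> * t) * (A * exp (\<omega> * t))"
        by (rule mult_left_mono) simp
      also have "\<dots> = A * exp ((\<omega> - \<mu>) * t)"
        by (simp add: left_diff_distrib exp_diff exp_minus field_simps)
      finally show ?thesis using const[OF s t] by (simp add: abs_mult)
    qed
    have "((\<lambda>t. A * exp ((\<omega> - \<mu>) * t)) \<longlongrightarrow> A * 0) at_top"
    proof (intro tendsto_mult_left filterlim_compose[OF exp_at_bot])
      show "filterlim (\<lambda>t. (\<omega> - \<mu>) * t) at_bot at_top"
        using \<mu> by (intro filterlim_tendsto_neg_mult_at_bot[OF tendsto_const] filterlim_ident) simp
    qed
    then have "norm (exp (- \<mu> * s) * y s) \<le> A * 0"
    proof (rule tendsto_lowerbound)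
      show "\<forall>\<^sub>F t in at_top. norm (exp (- \<mu> * s) * y s) \<le> A * exp ((\<omega> - \<mu>) * t)"
        using eventually_gt_at_top[of s] by eventually_elim (rule bound)
    qed simp
    then show ?thesis by simp
  qed
  have "((\<lambda>t. y t - x i) \<longlongrightarrow> 0) (at_right 0)"
    unfolding y_def
  proof (rule wnorm_tendsto_component[OF SM_strongly_continuous_0[OF x]])
    show "\<forall>\<^sub>F t in at_right 0. (\<lambda>i. matop (SM t) x i - x i) \<in> Xsp p"
      using pos
    proof eventually_elim
      case (elim t)
      then have "(\<lambda>i. matop (SM t) x i + (-1) * x i) \<in> Xsp p"
        using x by (intro Xsp_add Xsp_cmult SM_in_Xsp) auto
      then show ?case by simp
    qed
  qed
  then have "((\<lambda>t. - x i) \<longlongrightarrow> 0) (at_right (0::real))"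
    by (rule Lim_transform_eventually) (use pos in \<open>eventually_elim, simp add: y0\<close>)
  then show ?thesis by (simp add: tendsto_const_iff)
qed

text \<open>For maximality, let \<open>g\<close> be the generator applied to \<open>f\<close>, and
  let \<open>u\<close> in the smaller domain solve \<open>\<mu> u - Y u = \<mu> f - g\<close>. Then
  \<open>f - u\<close> is an eigenvector of the generator for \<open>\<mu>\<close>, hence
  zero.\<close>

lemma SM_is_generator:
  "is_generator p (\<lambda>t. matop (SM t)) (matop YM) {f \<in> Xsp p. (\<lambda>i. \<theta> i * f i) \<in> Xsp p}"
proof -
  have A: "matop YM f \<in> Xsp p"
    "((\<lambda>t. wnorm p (\<lambda>i. (matop (SM t) f i - f i) / t - matop YM f i)) \<longlongrightarrow> 0) (at_right 0)"
    if "f \<in> Xsp p" "(\<lambda>i. \<theta> i * f i) \<in> Xsp p" for f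
    using YM_in_Xsp[OF that] SM_generator[OF that(1) domain_summable[OF that]] by auto
  have "(\<lambda>i. \<theta> i * f i) \<in> Xsp p"
    if f: "f \<in> Xsp p" and g: "g \<in> Xsp p"
      and lim: "((\<lambda>t. wnorm p (\<lambda>i. (matop (SM t) f i - f i) / t - g i)) \<longlongrightarrow> 0) (at_right 0)" for f g
  proof -
    \<comment> \<open>A value strictly above \<open>\<omega>\<close> serves both the resolvent
      equation and injectivity.\<close>
    define \<mu> where "\<mu> = \<omega> + 1"
    have "(\<lambda>i. \<mu> * f i + (-1) * g i) \<in> Xsp p"
      by (intro Xsp_add Xsp_cmult f g)
    then obtain u where u: "u \<in> Xsp p" "(\<lambda>i. \<theta> i * u i) \<in> Xsp p" "\<And>i. \<mu> * u i - matop YM u i = \<mu> * f i - g i"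
      using resolvent_surj[of "\<lambda>i. \<mu> * f i + (-1) * g i" \<mu>] by (auto simp: \<mu>_def)
    define x where "x i = f i + (-1) * u i" for i
    have x: "x \<in> Xsp p" unfolding x_def by (intro Xsp_add Xsp_cmult f u)
    have "((\<lambda>t. wnorm p (\<lambda>i. (matop (SM t) x i - x i) / t - \<mu> * x i)) \<longlongrightarrow> 0) (at_right 0)"
    proof (rule tendsto_sandwich[OF _ _ tendsto_const])
      have pos: "\<forall>\<^sub>F h in at_right (0::real). 0 < h"
        by (simp add: eventually_at_right_less)
      have X: "(\<lambda>i. (matop (SM t) f i - f i) / t - g i) \<in> Xsp p"
        if "0 < t" "f \<in> Xsp p" "g \<in> Xsp p" for t f g
      proof -
        have "(\<lambda>i. 1 / t * (matop (SM t) f i + (-1) * f i) + (-1) * g i) \<in> Xsp p"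
          using that by (intro Xsp_add Xsp_cmult SM_in_Xsp) auto
        then show ?thesis by simp
      qed
      show "\<forall>\<^sub>F t in at_right 0. 0 \<le> wnorm p (\<lambda>i. (matop (SM t) x i - x i) / t - \<mu> * x i)"
        using pos by eventually_elim (intro wnorm_nonneg X x Xsp_cmult)
      show "((\<lambda>t. wnorm p (\<lambda>i. (matop (SM t) f i - f i) / t - g i) + wnorm p (\<lambda>i. (matop (SM t) u i - u i) / t - matop YM u i)) \<longlongrightarrow> 0) (at_right 0)"
        using tendsto_add[OF lim A(2)[OF u(1,2)]] by simp
      show "\<forall>\<^sub>F t in at_right 0. wnorm p (\<lambda>i. (matop (SM t) x i - x i) / t - \<mu> * x i)
          \<le> wnorm p (\<lambda>i. (matop (SM t) f i - f i) / t - g i) + wnorm p (\<lambda>i. (matop (SM t) u i - u i) / t - matop YM u i)"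
        using pos
      proof eventually_elim
        case (elim t)
        have "matop (SM t) x = (\<lambda>i. matop (SM t) f i + (-1) * matop (SM t) u i)"
          using SM_linear[OF _ f u(1), of t 1 "-1"] elim unfolding x_def[abs_def] by simp
        then have eq: "(matop (SM t) x i - x i) / t - \<mu> * x i
            = ((matop (SM t) f i - f i) / t - g i) - ((matop (SM t) u i - u i) / t - matop YM u i)" for i
          using u(3)[of i] by (simp add: x_def diff_divide_distrib add_divide_distrib algebra_simps)
        have s: "summable (\<lambda>i. real i powr p * norm ((matop (SM t) f i - f i) / t - g i))"
          "summable (\<lambda>i. real i powr p * norm ((matop (SM t) u i - u i) / t - matop YM u i))"
          using X[OF elim f g] X[OF elim u(1) YM_in_Xsp[OF u(1,2)]] by (simp_all add: Xsp_def)
        have s': "summable (\<lambda>i. real i powr p * norm ((matop (SM t) x i - x i) / t - \<mu> * x i))"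
          using X[OF elim x Xsp_cmult[OF x, of \<mu>]] by (simp add: Xsp_def)
        show ?case
          unfolding wnorm_def suminf_add[OF s]
        proof (rule suminf_le[OF _ s' summable_add[OF s]])
          fix i
          show "real i powr p * norm ((matop (SM t) x i - x i) / t - \<mu> * x i)
              \<le> real i powr p * norm ((matop (SM t) f i - f i) / t - g i) + real i powr p * norm ((matop (SM t) u i - u i) / t - matop YM u i)"
            unfolding eq distrib_left[symmetric] by (intro mult_left_mono norm_triangle_ineq4) simp
        qed
      qed
    qed
    then have "x i = 0" for i
      by (rule generator_inj[OF x, rotated]) (simp add: \<mu>_def)
    then have "f = u" by (auto simp: x_def fun_eq_iff)
    then show ?thesis using u by simp
  qed
  with A show ?thesis
    unfolding is_generator_def by blast
qed

text \<open>On the open sector the cosine of the argument exceeds \<open>c\<close>; the strict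
  inequality places it in the interior, where full complex derivatives exist.\<close>

lemma sector_subset: "sector (arccos c) \<subseteq> interior (ccone c)"
proof -
  have "c * norm z < Re z" if "z \<in> sector (arccos c)" for z
  proof -
    have z: "z \<noteq> 0" "\<bar>Arg z\<bar> < arccos c" using that by (auto simp: sector_def)
    have c1: "\<bar>c\<bar> \<le> 1" using c_pos \<kappa>c by auto
    have "cos (arccos c) < cos \<bar>Arg z\<bar>"
      using z arccos_bounded[of c] c1 by (intro cos_monotone_0_pi) auto
    then have "c < cos (Arg z)" using c1 by (simp add: cos_arccos_abs)
    then show ?thesis
      using z(1) cos_Arg[OF z(1)] by (simp add: field_simps)
  qed
  then show ?thesis using mem_interior_ccone by blast
qed

theorem generates_positive_analytic_semigroup:
  "\<exists>S. C0_semigroup p S \<and> positive_semigroup p S \<and> analytic_semigroup p S \<and>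
       is_generator p S (matop YM) {f \<in> Xsp p. (\<lambda>i. \<theta> i * f i) \<in> Xsp p}"
proof (intro exI conjI)
  have id: "matop (SM 0) f = f" if f: "f \<in> Xsp p" for f
  proof -
    have "SM 0 i j = idm i j" for i j
      by (simp add: SM_def TM_def W_0 unit_def idm_def)
    then have "matop (SM 0) f i = matop idm f i" for i by (simp add: matop_def)
    then show ?thesis using f by (simp add: fun_eq_iff matop_idm Xsp_def)
  qed
  show "C0_semigroup p (\<lambda>t. matop (SM t))"
    unfolding C0_semigroup_def
    using id SM_semigroup SM_strongly_continuous_0 matop_bounded_op[OF SM_colbd] by blast
  show "positive_semigroup p (\<lambda>t. matop (SM t))"
    unfolding positive_semigroup_def
  proof (intro allI impI ballI)
    fix t :: real and f :: "nat \<Rightarrow> real" and i assume t: "0 \<le> t" and f: "f \<in> Xsp p" "\<forall>i. 0 \<le> f i"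
    show "0 \<le> matop (SM t) f i"
      unfolding matop_def using f(2) SM_nonneg[OF t]
      by (intro suminf_nonneg summable_norm_cancel[OF matop_summable[OF SM_colbd[OF t] Xsp_summable[OF f(1)]]]) auto
  qed
  show "is_generator p (\<lambda>t. matop (SM t)) (matop YM) {f \<in> Xsp p. (\<lambda>i. \<theta> i * f i) \<in> Xsp p}"
    by (rule SM_is_generator)
  have sec: "sector (arccos c) \<subseteq> ccone c"
    using sector_subset interior_subset by blast
  show "analytic_semigroup p (\<lambda>t. matop (SM t))"
    unfolding analytic_semigroup_def
  proof (intro exI conjI)
    show "0 < arccos c" using arccos_lt_bounded[of c] c_pos \<kappa>c by simp
    show "\<forall>t\<ge>0. \<forall>h\<in>Xsp p. matop (TM (complex_of_real t)) h = cplx (matop (SM t)) h"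
      using matop_TM_cplx by blast
    show "\<forall>z\<in>sector (arccos c). bounded_op p (matop (TM z))"
      using sec matop_bounded_op[OF TM_colbd] by blast
    show "\<forall>z1\<in>sector (arccos c). \<forall>z2\<in>sector (arccos c). \<forall>h\<in>Xsp p. matop (TM (z1 + z2)) h = matop (TM z1) (matop (TM z2) h)"
      using sec TM_semigroup by blast
    show "\<forall>h\<in>Xsp p. \<forall>z0\<in>sector (arccos c). \<exists>g\<in>Xsp p.
        ((\<lambda>z. wnorm p (\<lambda>i. (matop (TM z) h i - matop (TM z0) h i) / (z - z0) - g i)) \<longlongrightarrow> 0) (at z0)"
      using sector_subset TM_holomorphic by blast
    show "\<forall>h\<in>Xsp p. ((\<lambda>z. wnorm p (\<lambda>i. matop (TM z) h i - h i)) \<longlongrightarrow> 0) (at 0 within sector (arccos c))"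
      using tendsto_within_subset[OF TM_strongly_continuous_0 sec] by blast
  qed
qed

end

subsection \<open>The growth-decay-fragmentation operator\<close>

text \<open>For \<open>r \<le> s\<close> powers of \<open>x\<close> decrease in the exponent. For
  \<open>s < r\<close>, \<open>x powr s\<close> is a concave function of \<open>x powr r\<close> and
  lies below its tangent at 1, which is Young's inequality with second factor 1.\<close>

lemma one_minus_powr_compare:
  fixes x r s :: real
  assumes x: "0 < x" "x \<le> 1" and r: "0 < r" and s: "0 < s"
  shows "min 1 (s / r) * (1 - x powr r) \<le> 1 - x powr s"
proof (cases "r \<le> s")
  case True
  then have "x powr s \<le> x powr r" using x by (intro powr_mono') auto
  then show ?thesis using True r by (simp add: min_def)
next
  case False
  then have m: "min 1 (s / r) = s / r" using r by simp
  have "(x powr r) powr (s / r) * 1 powr (1 - s / r) \<le> s / r * x powr r + (1 - s / r) * 1"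
    using False x r s by (intro Youngs_inequality_0) auto
  moreover have "(x powr r) powr (s / r) = x powr s"
    using r by (simp add: powr_powr)
  ultimately show ?thesis unfolding m by (simp add: algebra_simps)
qed

text \<open>By the mass condition the numbers \<open>real j * \<beta> j / real i\<close> are
  probability weights, and the relative deficit of order \<open>r\<close> is the mean of
  \<open>1 - (j / i) powr (r - 1)\<close>. The comparison of powers applies inside the mean, with
  the positive exponents \<open>p0 - 1\<close> and \<open>p - 1\<close>.\<close>

lemma moment_deficit_compare:
  fixes \<beta> :: "nat \<Rightarrow> real"
  assumes i: "1 \<le> i" and \<beta>: "\<And>j. j \<in> {1..i-1} \<Longrightarrow> 0 \<le> \<beta> j" and mass: "(\<Sum>j=1..i-1. real j * \<beta> j) = real i"
    and p0: "1 < p0" and p: "1 < p"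
  shows "min 1 ((p - 1) / (p0 - 1)) * ((real i powr p0 - (\<Sum>j=1..i-1. real j powr p0 * \<beta> j)) / real i powr p0)
    \<le> (real i powr p - (\<Sum>j=1..i-1. real j powr p * \<beta> j)) / real i powr p"
proof -
  have eq: "(real i powr r - (\<Sum>j=1..i-1. real j powr r * \<beta> j)) / real i powr r
      = (\<Sum>j=1..i-1. (real j * \<beta> j / real i) * (1 - (real j / real i) powr (r - 1)))" for r
  proof -
    have 1: "(\<Sum>j=1..i-1. real j * \<beta> j / real i) = 1"
      using mass i by (simp flip: sum_divide_distrib)
    have 2: "(real j * \<beta> j / real i) * (real j / real i) powr (r - 1) = real j powr r * \<beta> j / real i powr r" if "j \<in> {1..i-1}" for j
      using that i by (simp add: powr_divide powr_diff field_simps)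
    have "(\<Sum>j=1..i-1. (real j * \<beta> j / real i) * (1 - (real j / real i) powr (r - 1)))
        = (\<Sum>j=1..i-1. real j * \<beta> j / real i) - (\<Sum>j=1..i-1. (real j * \<beta> j / real i) * (real j / real i) powr (r - 1))"
      by (simp add: right_diff_distrib sum_subtractf)
    also have "\<dots> = 1 - (\<Sum>j=1..i-1. real j powr r * \<beta> j / real i powr r)"
      unfolding 1 by (intro arg_cong2[where f = "(-)"] sum.cong refl 2)
    finally show ?thesis using i by (simp add: diff_divide_distrib sum_divide_distrib)
  qed
  show ?thesis
    unfolding eq sum_distrib_left
  proof (rule sum_mono)
    fix j assume j: "j \<in> {1..i-1}"
    have "min 1 ((p - 1) / (p0 - 1)) * (1 - (real j / real i) powr (p0 - 1)) \<le> 1 - (real j / real i) powr (p - 1)"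
      using j p p0 by (intro one_minus_powr_compare) auto
    then have "(real j * \<beta> j / real i) * (min 1 ((p - 1) / (p0 - 1)) * (1 - (real j / real i) powr (p0 - 1)))
        \<le> (real j * \<beta> j / real i) * (1 - (real j / real i) powr (p - 1))"
      using \<beta>[OF j] by (intro mult_left_mono) auto
    then show "min 1 ((p - 1) / (p0 - 1)) * (real j * \<beta> j / real i * (1 - (real j / real i) powr (p0 - 1)))
        \<le> (real j * \<beta> j / real i) * (1 - (real j / real i) powr (p - 1))"
      by (simp only: mult_ac)
  qed
qed

text \<open>The off-diagonal rates from \<open>j\<close> to \<open>k\<close>. Index 0 is cut off on
  both sides because the parameters are constrained from index 1 on; in particular
  \<open>d 1\<close> has no target and acts as pure loss.\<close>

definition gain :: "(nat \<Rightarrow> real) \<Rightarrow> (nat \<Rightarrow> real) \<Rightarrow> (nat \<Rightarrow> real) \<Rightarrow> (nat \<Rightarrow> nat \<Rightarrow> real) \<Rightarrow> nat \<Rightarrow> nat \<Rightarrow> real" where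
  "gain g d a b k j = (if k = 0 \<or> j = 0 then 0 else
     (if k = j + 1 then g j else 0) + (if j = k + 1 then d j else 0) + (if k < j then a j * b k j else 0))"

text \<open>At \<open>j = 1\<close> the decay term is \<open>0 powr p * d 1 = 0\<close>, in
  agreement with the cut-off at index 0.\<close>

lemma gain_column_sum:
  assumes "1 \<le> j"
  shows "(\<Sum>k\<le>j+1. real k powr p * gain g d a b k j)
    = real (j + 1) powr p * g j + real (j - 1) powr p * d j + a j * (\<Sum>k=1..j-1. real k powr p * b k j)"
proof -
  have "(\<Sum>k\<le>j+1. real k powr p * gain g d a b k j)
      = (\<Sum>k\<le>j+1. (if k = j + 1 then real k powr p * g j else 0) + (if k = j - 1 then real k powr p * d j else 0)
          + (if k \<in> {1..j-1} then a j * (real k powr p * b k j) else 0))"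
  proof (rule sum.cong[OF refl])
    fix k assume "k \<in> {..j+1}"
    show "real k powr p * gain g d a b k j = (if k = j + 1 then real k powr p * g j else 0) + (if k = j - 1 then real k powr p * d j else 0)
          + (if k \<in> {1..j-1} then a j * (real k powr p * b k j) else 0)"
      using assms by (cases "k = 0") (auto simp: gain_def algebra_simps)
  qed
  also have "\<dots> = real (j + 1) powr p * g j + real (j - 1) powr p * d j + (\<Sum>k\<le>j+1. if k \<in> {1..j-1} then a j * (real k powr p * b k j) else 0)"
    unfolding sum.distrib sum.delta[OF finite_atMost] by simp
  also have "(\<Sum>k\<le>j+1. if k \<in> {1..j-1} then a j * (real k powr p * b k j) else 0) = (\<Sum>k=1..j-1. a j * (real k powr p * b k j))"
    by (rule sum.mono_neutral_cong_right) auto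
  finally show ?thesis by (simp add: sum_distrib_left)
qed

lemma liminf_posD:
  fixes f :: "nat \<Rightarrow> real"
  assumes "liminf (\<lambda>i. ereal (f i)) > 0"
  shows "\<exists>\<epsilon>>0. eventually (\<lambda>i. \<epsilon> < f i) sequentially"
proof -
  obtain e where e: "0 < ereal e" "ereal e < liminf (\<lambda>i. ereal (f i))"
    using ereal_dense2[OF assms] by auto
  from less_LiminfD[OF e(2)] e(1) show ?thesis by auto
qed

text \<open>A budget per column: without fragmentation loss and growth excess the moment is at most
  \<open>\<theta> j * real j powr p\<close>; for large \<open>j\<close> fragmentation takes away a
  share \<open>\<gamma>\<close>, and growth to size \<open>j + 1\<close> returns at most half of
  it.\<close>

lemma gain_relatively_bounded:
  fixes g d s a \<theta> :: "nat \<Rightarrow> real" and b :: "nat \<Rightarrow> nat \<Rightarrow> real" and \<Delta> :: "real \<Rightarrow> nat \<Rightarrow> real"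
  assumes g_nn: "\<forall>i\<ge>1. 0 \<le> g i" and d_nn: "\<forall>i\<ge>1. 0 \<le> d i"
    and s_nn: "\<forall>i\<ge>1. 0 \<le> s i" and a_nn: "\<forall>i\<ge>1. 0 \<le> a i"
    and b_nn: "\<forall>i\<ge>1. \<forall>j\<ge>1. 0 \<le> b i j" and a_pos: "\<forall>i\<ge>2. 0 < a i"
    and b_mass: "\<forall>j\<ge>2. (\<Sum>i=1..j-1. real i * b i j) = real j"
    and \<theta>_def: "\<forall>i. \<theta> i = a i + g i + d i + s i"
    and \<Delta>_def: "\<forall>q i. \<Delta> q i = real i powr q - (\<Sum>j=1..i-1. real j powr q * b j i)"
    and p0: "p0 > 1" and p: "p > 1"
    and liminf: "liminf (\<lambda>i. ereal (a i / \<theta> i * (\<Delta> p0 i / real i powr p0))) > 0"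
  shows "\<exists>\<kappa> \<omega>. 0 < \<kappa> \<and> \<kappa> < 1 \<and> 0 < \<omega> \<and>
    (\<forall>j\<ge>1. (\<Sum>k\<le>j+1. real k powr p * gain g d a b k j) \<le> \<kappa> * (\<theta> j + \<omega>) * real j powr p)"
proof -
  obtain \<epsilon> where \<epsilon>: "0 < \<epsilon>" and ev\<epsilon>: "eventually (\<lambda>i. \<epsilon> < a i / \<theta> i * (\<Delta> p0 i / real i powr p0)) sequentially"
    using liminf_posD[OF liminf] by blast
  define \<eta> where "\<eta> = min 1 ((p - 1) / (p0 - 1))"
  have \<eta>: "0 < \<eta>" using p p0 by (simp add: \<eta>_def)
  \<comment> \<open>\<open>\<eta>\<close> transfers the liminf bound \<open>\<epsilon>\<close> from
    \<open>p0\<close> to \<open>p\<close>; the cap at 1 keeps \<open>\<kappa>\<close>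
    positive.\<close>
  define \<gamma> where "\<gamma> = min 1 (\<eta> * \<epsilon>)"
  have \<gamma>: "0 < \<gamma>" "\<gamma> \<le> 1" "\<gamma> \<le> \<eta> * \<epsilon>" using \<eta> \<epsilon> by (auto simp: \<gamma>_def)
  \<comment> \<open>The remaining half of \<open>\<gamma>\<close> covers the growth excess, since
    \<open>(1 + 1 / j) powr p\<close> is eventually below \<open>1 + \<gamma> / 2\<close>.\<close>
  define \<kappa> where "\<kappa> = 1 - \<gamma> / 2"
  have \<kappa>: "0 < \<kappa>" "\<kappa> < 1" using \<gamma> by (auto simp: \<kappa>_def)
  define \<beta> where "\<beta> j = (\<Sum>k\<le>j+1. real k powr p * gain g d a b k j)" for j
  have "(\<lambda>j. (1 + 1 / real j) powr p) \<longlonglongrightarrow> (1 + 0) powr p"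
    by (intro tendsto_intros lim_1_over_n) auto
  then have "eventually (\<lambda>j. (1 + 1 / real j) powr p < 1 + \<gamma> / 2) sequentially"
    using \<gamma> by (intro order_tendstoD(2)) auto
  then have "eventually (\<lambda>j. \<beta> j \<le> \<kappa> * \<theta> j * real j powr p) sequentially"
    using ev\<epsilon> eventually_ge_at_top[of 2]
  proof eventually_elim
    case (elim j)
    have \<theta>: "0 < \<theta> j" "a j \<le> \<theta> j" "g j \<le> \<theta> j" "0 \<le> g j" "0 \<le> d j"
      using elim a_pos g_nn d_nn s_nn by (auto simp: \<theta>_def add_pos_nonneg)
    have jp: "0 < real j powr p" using elim by simp
    have "\<eta> * (\<Delta> p0 j / real j powr p0) \<le> \<Delta> p j / real j powr p"
      unfolding \<Delta>_def[rule_format] \<eta>_def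
      using elim b_nn b_mass p p0 by (intro moment_deficit_compare) auto
    then have "a j / \<theta> j * (\<eta> * (\<Delta> p0 j / real j powr p0)) \<le> a j / \<theta> j * (\<Delta> p j / real j powr p)"
      using elim \<theta> a_nn by (intro mult_left_mono) auto
    moreover have "\<eta> * \<epsilon> \<le> \<eta> * (a j / \<theta> j * (\<Delta> p0 j / real j powr p0))"
      using elim \<eta> by (intro mult_left_mono) auto
    ultimately have "\<gamma> \<le> a j / \<theta> j * (\<Delta> p j / real j powr p)"
      using \<gamma> by (simp add: mult.left_commute)
    then have a\<Delta>: "\<gamma> * \<theta> j * real j powr p \<le> a j * \<Delta> p j"
      using \<theta> jp by (simp add: field_simps)
    have "real (j + 1) = real j * (1 + 1 / real j)" using elim by (simp add: field_simps)
    then have "real (j + 1) powr p = real j powr p * (1 + 1 / real j) powr p"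
      by (simp add: powr_mult)
    also have "\<dots> \<le> real j powr p * (1 + \<gamma> / 2)" using elim by (intro mult_left_mono) auto
    finally have g1: "real (j + 1) powr p * g j \<le> real j powr p * (1 + \<gamma> / 2) * g j"
      using \<theta> by (intro mult_right_mono)
    have g2: "real j powr p * (\<gamma> / 2) * g j \<le> real j powr p * (\<gamma> / 2) * \<theta> j"
      using \<theta> \<gamma> by (intro mult_left_mono) auto
    have d1: "real (j - 1) powr p * d j \<le> real j powr p * d j"
      using \<theta> p by (intro mult_right_mono powr_mono2) auto
    have s1: "0 \<le> real j powr p * s j" using s_nn elim by simp
    have "\<beta> j = real (j + 1) powr p * g j + real (j - 1) powr p * d j + a j * (real j powr p - \<Delta> p j)"
      unfolding \<beta>_def using elim by (subst gain_column_sum) (auto simp: \<Delta>_def)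
    also have "\<dots> \<le> real j powr p * (a j + g j + d j + s j) + real j powr p * (\<gamma> / 2) * \<theta> j - \<gamma> * \<theta> j * real j powr p"
      using g1 g2 d1 s1 a\<Delta> by (simp add: algebra_simps)
    also have "\<dots> = \<kappa> * \<theta> j * real j powr p"
      unfolding \<theta>_def[rule_format, symmetric] by (simp add: \<kappa>_def algebra_simps)
    finally show ?case .
  qed
  then obtain N where N: "\<And>j. j \<ge> N \<Longrightarrow> \<beta> j \<le> \<kappa> * \<theta> j * real j powr p"
    by (auto simp: eventually_sequentially)
  \<comment> \<open>The sum makes \<open>\<kappa> * \<omega>\<close> exceed each of the finitely
    many column moments below \<open>N\<close>, where the weight is at least 1; the summand 1 keeps
    \<open>\<omega>\<close> positive.\<close>
  define \<omega> where "\<omega> = 1 + (\<Sum>j<N. \<bar>\<beta> j\<bar> / \<kappa>)"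
  have \<omega>: "1 \<le> \<omega>" using \<kappa> by (simp add: \<omega>_def sum_nonneg)
  have "\<beta> j \<le> \<kappa> * (\<theta> j + \<omega>) * real j powr p" if j: "1 \<le> j" for j
  proof (cases "N \<le> j")
    case True
    have "\<kappa> * \<theta> j * real j powr p \<le> \<kappa> * (\<theta> j + \<omega>) * real j powr p"
      using \<kappa> \<omega> by (intro mult_right_mono mult_left_mono) auto
    then show ?thesis using N[OF True] by linarith
  next
    case False
    have "\<bar>\<beta> j\<bar> / \<kappa> \<le> (\<Sum>j<N. \<bar>\<beta> j\<bar> / \<kappa>)"
      using False \<kappa> by (intro member_le_sum) auto
    then have "\<bar>\<beta> j\<bar> \<le> \<kappa> * \<omega>"
      using \<kappa> by (simp add: \<omega>_def field_simps)
    also have "\<dots> \<le> \<kappa> * (\<theta> j + \<omega>)"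
      using \<kappa> j a_nn g_nn d_nn s_nn by (intro mult_left_mono) (auto simp: \<theta>_def)
    finally have "\<bar>\<beta> j\<bar> \<le> \<kappa> * (\<theta> j + \<omega>)" .
    moreover have "1 \<le> real j powr p" using j p by (simp add: ge_one_powr_ge_zero)
    ultimately have "\<bar>\<beta> j\<bar> * 1 \<le> \<kappa> * (\<theta> j + \<omega>) * real j powr p"
      by (intro mult_mono) auto
    then show ?thesis by simp
  qed
  then show ?thesis using \<kappa> \<omega> unfolding \<beta>_def by (intro exI[of _ \<kappa>] exI[of _ \<omega>]) auto
qed

theorem theorem2p1:
  fixes g d s a \<theta> :: "nat \<Rightarrow> real" and b :: "nat \<Rightarrow> nat \<Rightarrow> real"
    and \<Delta> :: "real \<Rightarrow> nat \<Rightarrow> real" and p0 :: real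
  assumes g_nn: "\<forall>i\<ge>1. 0 \<le> g i" and d_nn: "\<forall>i\<ge>1. 0 \<le> d i"
    and s_nn: "\<forall>i\<ge>1. 0 \<le> s i" and a_nn: "\<forall>i\<ge>1. 0 \<le> a i"
    and b_nn: "\<forall>i\<ge>1. \<forall>j\<ge>1. 0 \<le> b i j"
    and a1: "a 1 = 0" and a_pos: "\<forall>i\<ge>2. 0 < a i"
    and b_zero: "\<forall>i\<ge>1. \<forall>j\<ge>1. j \<le> i \<longrightarrow> b i j = 0"
    and b_mass: "\<forall>j\<ge>2. (\<Sum>i=1..j-1. real i * b i j) = real j"
    and g0: "g 0 = 0"
    and \<theta>_def: "\<forall>i. \<theta> i = a i + g i + d i + s i"
    and \<Delta>_def: "\<forall>q i. \<Delta> q i = real i powr q - (\<Sum>j=1..i-1. real j powr q * b j i)"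
    and p0: "p0 > 1"
    and liminf: "liminf (\<lambda>i. ereal (a i / \<theta> i * (\<Delta> p0 i / real i powr p0))) > 0"
  shows "\<forall>p>1. \<exists>S. C0_semigroup p S \<and> positive_semigroup p S \<and> analytic_semigroup p S \<and>
            is_generator p S (Yop \<theta> g d a b) {f \<in> Xsp p. (\<lambda>i. \<theta> i * f i) \<in> Xsp p}"
proof (intro allI impI)
  fix p :: real assume p: "1 < p"
  obtain \<kappa> \<omega> where \<kappa>: "0 < \<kappa>" "\<kappa> < 1" and \<omega>: "0 < \<omega>"
    and col: "\<And>j. 1 \<le> j \<Longrightarrow> (\<Sum>k\<le>j+1. real k powr p * gain g d a b k j) \<le> \<kappa> * (\<theta> j + \<omega>) * real j powr p"
    using gain_relatively_bounded[OF g_nn d_nn s_nn a_nn b_nn a_pos b_mass \<theta>_def \<Delta>_def p0 p liminf] by blast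
  \<comment> \<open>The value \<open>\<theta> 0\<close> may be negative, as the assumptions do not
    fix its sign; replacing it changes nothing on sequences with \<open>f 0 = 0\<close>.\<close>
  let ?\<theta> = "\<theta>(0 := 0)" and ?B = "gain g d a b"
  \<comment> \<open>The midpoint of \<open>\<kappa>\<close> and 1 is one choice of a cone parameter
    strictly between them.\<close>
  interpret weighted_kolmogorov p ?\<theta> ?B \<kappa> "(1 + \<kappa>) / 2" \<omega>
  proof
    show "(\<Sum>k\<le>j+1. real k powr p * ?B k j) \<le> \<kappa> * (?\<theta> j + \<omega>) * real j powr p" for j
      using col[of j] by (cases "j = 0") (auto simp: gain_def)
    show "0 \<le> ?\<theta> j" for j
      using a_nn g_nn d_nn s_nn by (auto simp: \<theta>_def)
    show "0 \<le> ?B k j" for k j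
      using a_nn g_nn d_nn b_nn by (auto simp: gain_def)
  qed (use \<kappa> \<omega> in \<open>auto simp: gain_def\<close>)
  have dom: "{f \<in> Xsp p. (\<lambda>i. ?\<theta> i * f i) \<in> Xsp p} = {f \<in> Xsp p. (\<lambda>i. \<theta> i * f i) \<in> Xsp p}"
  proof -
    have "(\<lambda>i. ?\<theta> i * f i) = (\<lambda>i. \<theta> i * f i)" if "f \<in> Xsp p" for f :: "nat \<Rightarrow> real"
      using that by (auto simp: Xsp_def)
    then show ?thesis by (simp cong: conj_cong)
  qed
  have Y: "matop YM f = Yop \<theta> g d a b f" if f: "f \<in> Xsp p" "(\<lambda>i. ?\<theta> i * f i) \<in> Xsp p" for f
  proof
    fix i
    show "matop YM f i = Yop \<theta> g d a b f i"
    proof (cases "i = 0")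
      case True
      then show ?thesis by (simp add: matop_def YM_def Yop_def)
    next
      case False
      have f0: "f 0 = 0" using f by (simp add: Xsp_def)
      have "summable (\<lambda>j. norm (YM i j * f j))"
        using summable_mult[OF domain_summable[OF f], of 2]
        by (intro matop_summable[OF YM_colbd]) (simp add: mult.assoc)
      then have "(\<lambda>j. YM i j * f j) sums matop YM f i"
        unfolding matop_def by (rule summable_sums[OF summable_norm_cancel])
      \<comment> \<open>Removing the diagonal, growth and decay entries from the absolutely
        convergent row leaves the fragmentation series, so its convergence comes along. For
        \<open>i = 1\<close> the growth entry sits at index 0, where \<open>f\<close>
        vanishes.\<close>
      then have "(\<lambda>j. YM i j * f j - (if j = i then - \<theta> j * f j else 0) - (if j = i - 1 then g j * f j else 0)
            - (if j = i + 1 then d j * f j else 0)) sums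
          (matop YM f i - (- \<theta> i * f i) - g (i - 1) * f (i - 1) - d (i + 1) * f (i + 1))"
        by (intro sums_diff sums_single)
      moreover have "YM i j * f j - (if j = i then - \<theta> j * f j else 0) - (if j = i - 1 then g j * f j else 0)
            - (if j = i + 1 then d j * f j else 0) = (if i < j then a j * b i j * f j else 0)" for j
        using False f0 by (cases "j = 0") (auto simp: YM_def gain_def algebra_simps)
      ultimately have "(\<Sum>j. if i < j then a j * b i j * f j else 0)
          = matop YM f i - (- \<theta> i * f i) - g (i - 1) * f (i - 1) - d (i + 1) * f (i + 1)"
        by (simp add: sums_iff)
      then show ?thesis using False by (simp add: Yop_def)
    qed
  qed
  obtain S where S: "C0_semigroup p S" "positive_semigroup p S" "analytic_semigroup p S"
    and gen: "is_generator p S (matop YM) {f \<in> Xsp p. (\<lambda>i. ?\<theta> i * f i) \<in> Xsp p}"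
    using generates_positive_analytic_semigroup by blast
  have "is_generator p S (Yop \<theta> g d a b) {f \<in> Xsp p. (\<lambda>i. ?\<theta> i * f i) \<in> Xsp p}"
    using gen Y unfolding is_generator_def by auto
  then have "is_generator p S (Yop \<theta> g d a b) {f \<in> Xsp p. (\<lambda>i. \<theta> i * f i) \<in> Xsp p}"
    unfolding dom .
  with S show "\<exists>S. C0_semigroup p S \<and> positive_semigroup p S \<and> analytic_semigroup p S \<and>
      is_generator p S (Yop \<theta> g d a b) {f \<in> Xsp p. (\<lambda>i. \<theta> i * f i) \<in> Xsp p}"
    by blast
qed

end
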